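(* Let $T>0$. Let $g\in C^2(\mathbb{R}^N;\mathcal{S}^N)$ be uniformly positive definite, i.e. there is $C>0$ such that $\frac1C|w|^2\le (g(x)w,w)\le C|w|^2$ for all $x,w\in\mathbb{R}^N$, and assume that there exists $\Upsilon>0$ such that $e_g\in C^1(\{(x,y)\in\mathbb{R}^N\times\mathbb{R}^N: d_g(x,y)<\Upsilon\})$. Let $\xi,\zeta\in C^1_0([0,T];\mathbb{R})$ and $u_0,v_0\in \mathrm{BUC}_g(\mathbb{R}^N)$. Let $u\in \mathrm{BUSC}(\mathbb{R}^N\times[0,T])$ be a viscosity sub-solution of $$u_t-(g^{-1}(x)Du,Du)\,\dot\xi\le 0\ \text{ in }\mathbb{R}^N\times(0,T],\qquad u(\cdot,0)\le u_0\ \text{ on }\mathbb{R}^N,$$ and let $v\in \mathrm{BLSC}(\mathbb{R}^N\times[0,T])$ be a viscosity super-solution of $$v_t-(g^{-1}(x)Dv,Dv)\,\dot\zeta\ge 0\ \text{ in }\mathbb{R}^N\times(0,T],\qquad v(\cdot,0)\ge v_0\ \text{ on }\mathbb{R}^N.$$ If $$\Delta_T^++\Delta_T^-<\frac{1}{2\left(\|u_0\|_{\infty;\mathbb{R}^N}+\|v_0\|_{\infty;\mathbb{R}^N}\right)}\,\Upsilon^2,$$ then $$\sup_{\mathbb{R}^N\times[0,T]}(u-v)\le \sup_{\mathbb{R}^N}(u_0-v_0)+\theta\!\left(\omega_{u_0}\wedge\omega_{v_0},\frac{1}{\Delta_T^+}\right).$$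
   Context: $\mathcal{S}^N$ is the space of symmetric $N\times N$ real matrices and $(\cdot,\cdot)$ is the Euclidean inner product on $\mathbb{R}^N$. $g^{-1}(x)$ is the inverse matrix of $g(x)$. The distance associated with $g$ is $$d_g(x,y)=\inf\Big\{\int_0^1\tfrac12(g(\gamma_t)\dot\gamma_t,\dot\gamma_t)^{1/2}dt:\ \gamma\in C^1([0,1],\mathbb{R}^N),\ \gamma_0=x,\ \gamma_1=y\Big\},$$ and the energy is $$e_g(x,y)=d_g(x,y)^2=\inf\Big\{\int_0^1\tfrac14(g(\gamma_t)\dot\gamma_t,\dot\gamma_t)dt:\ \gamma\in C^1([0,1],\mathbb{R}^N),\ \gamma_0=x,\ \gamma_1=y\Big\}.$$ A modulus is a nondecreasing, subadditive function $\omega:[0,\infty)\to[0,\infty)$ with $\lim_{r\to0}\omega(r)=\omega(0)=0$. $\mathrm{BUC}_g(\mathbb{R}^N)$ is the set of bounded $u:\mathbb{R}^N\to\mathbb{R}$ with $|u(x)-u(y)|\le\omega(d_g(x,y))$ for all $x,y$ for some modulus $\omega$; such a modulus, which may be taken bounded, is denoted $\omega_u$. $\mathrm{BUSC}$ (resp. $\mathrm{BLSC}$) denotes bounded upper (resp. lower) semicontinuous functions. $a\wedge b=\min(a,b)$ (for functions, pointwise), and $\|u\|_{\infty;A}=\sup_A|u|$. $C^1_0([0,T];\mathbb{R})=\{\zeta\in C^1([0,T];\mathbb{R}):\zeta_0=0\}$. For $\xi,\zeta\in C_0^1([0,T];\mathbb{R})$, $$\Delta_T^+=\max_{s\le T}(\xi_s-\zeta_s)\ge0,\qquad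 \Delta_T^-=\max_{s\le T}\{-(\xi_s-\zeta_s)\}\ge0.$$ For a modulus $\omega$ (or a minimum of two moduli) and $\lambda>0$, $\theta(\omega,\lambda)=\sup_{r\ge0}\{\omega(r)-\lambda r^2/2\}$. Conventions: $1/0=+\infty$ and $\theta(\omega,+\infty)=0$. Sub- and super-solutions are understood in the classical Crandall–Lions viscosity sense. *)

theory Defs
  imports "HOL-Analysis.Analysis"
begin

text \<open>
  \<open>C\<^sup>1\<close> and \<open>C\<^sup>2\<close> on a set, with derivatives taken within the set.  All sets used below are open
  or convex with nonempty interior, so these derivatives are unique and are one-sided at boundary
  points.
\<close>

definition C1_on :: "('a::real_normed_vector \<Rightarrow> 'b::real_normed_vector) \<Rightarrow> 'a set \<Rightarrow> bool" where
  "C1_on f S \<longleftrightarrow> (\<exists>f' :: 'a \<Rightarrow> 'a \<Rightarrow>\<^sub>L 'b.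
     (\<forall>x\<in>S. (f has_derivative blinfun_apply (f' x)) (at x within S)) \<and> continuous_on S f')"

definition C2_on :: "('a::real_normed_vector \<Rightarrow> 'b::real_normed_vector) \<Rightarrow> 'a set \<Rightarrow> bool" where
  "C2_on f S \<longleftrightarrow> (\<exists>f' :: 'a \<Rightarrow> 'a \<Rightarrow>\<^sub>L 'b.
     (\<forall>x\<in>S. (f has_derivative blinfun_apply (f' x)) (at x within S)) \<and> C1_on f' S)"

definition C1_0 :: "real \<Rightarrow> (real \<Rightarrow> real) set" where
  "C1_0 T = {\<zeta>. C1_on \<zeta> {0..T} \<and> \<zeta> 0 = 0}"

definition g_length :: "(real^'n \<Rightarrow> real^'n^'n) \<Rightarrow> (real \<Rightarrow> real^'n) \<Rightarrow> real" where
  "g_length g \<gamma> = integral {0..1}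
     (\<lambda>t. 1/2 * sqrt ((g (\<gamma> t) *v vector_derivative \<gamma> (at t within {0..1}))
                        \<bullet> vector_derivative \<gamma> (at t within {0..1})))"

definition d_g :: "(real^'n \<Rightarrow> real^'n^'n) \<Rightarrow> real^'n \<Rightarrow> real^'n \<Rightarrow> real" where
  "d_g g x y = Inf {g_length g \<gamma> | \<gamma>. C1_on \<gamma> {0..1} \<and> \<gamma> 0 = x \<and> \<gamma> 1 = y}"

definition e_g :: "(real^'n \<Rightarrow> real^'n^'n) \<Rightarrow> real^'n \<Rightarrow> real^'n \<Rightarrow> real" where
  "e_g g x y = (d_g g x y)\<^sup>2"

text \<open>Moduli are functions on \<open>[0,\<infinity>)\<close>; the values at negative arguments are irrelevant.\<close>

definition modulus :: "(real \<Rightarrow> real) \<Rightarrow> bool" where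
  "modulus \<omega> \<longleftrightarrow> (\<forall>r\<ge>0. 0 \<le> \<omega> r) \<and> mono_on {0..} \<omega>
     \<and> (\<forall>r\<ge>0. \<forall>s\<ge>0. \<omega> (r + s) \<le> \<omega> r + \<omega> s)
     \<and> \<omega> 0 = 0 \<and> (\<omega> \<longlongrightarrow> 0) (at_right 0)"

definition modulus_of ::
    "(real^'n \<Rightarrow> real^'n^'n) \<Rightarrow> (real \<Rightarrow> real) \<Rightarrow> (real^'n \<Rightarrow> real) \<Rightarrow> bool" where
  "modulus_of g \<omega> u \<longleftrightarrow> modulus \<omega> \<and> (\<forall>x y. \<bar>u x - u y\<bar> \<le> \<omega> (d_g g x y))"

definition BUC_g :: "(real^'n \<Rightarrow> real^'n^'n) \<Rightarrow> (real^'n \<Rightarrow> real) set" where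
  "BUC_g g = {u. bounded (range u) \<and> (\<exists>\<omega>. modulus_of g \<omega> u)}"

definition BUSC :: "'a::topological_space set \<Rightarrow> ('a \<Rightarrow> real) set" where
  "BUSC S = {u. bounded (u ` S) \<and> (\<forall>c. openin (top_of_set S) {z \<in> S. u z < c})}"

definition BLSC :: "'a::topological_space set \<Rightarrow> ('a \<Rightarrow> real) set" where
  "BLSC S = {v. bounded (v ` S) \<and> (\<forall>c. openin (top_of_set S) {z \<in> S. c < v z})}"

text \<open>
  Viscosity sub- and super-solutions of \<open>u\<^sub>t + F(x,t,Du) = 0\<close> in \<open>\<real>\<^sup>N \<times> (0,T]\<close>.  Local extrema and
  test functions are relative to \<open>\<real>\<^sup>N \<times> (0,T]\<close>, so at \<open>t = T\<close> both are one-sided in time.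
  The pair \<open>(p, a)\<close> is \<open>(D\<phi>(x,t), \<phi>\<^sub>t(x,t))\<close>.
\<close>

definition viscosity_subsolution ::
    "(real^'n \<Rightarrow> real \<Rightarrow> real^'n \<Rightarrow> real) \<Rightarrow> real \<Rightarrow> ((real^'n) \<times> real \<Rightarrow> real) \<Rightarrow> bool" where
  "viscosity_subsolution F T u \<longleftrightarrow>
     (\<forall>\<phi> x t p a.
        C1_on \<phi> (UNIV \<times> {0<..T}) \<longrightarrow> t \<in> {0<..T} \<longrightarrow>
        (\<forall>\<^sub>F z in at (x, t) within UNIV \<times> {0<..T}. u z - \<phi> z \<le> u (x, t) - \<phi> (x, t)) \<longrightarrow>
        (\<phi> has_derivative (\<lambda>(h, s). p \<bullet> h + a * s)) (at (x, t) within UNIV \<times> {0<..T}) \<longrightarrow>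
        a + F x t p \<le> 0)"

definition viscosity_supersolution ::
    "(real^'n \<Rightarrow> real \<Rightarrow> real^'n \<Rightarrow> real) \<Rightarrow> real \<Rightarrow> ((real^'n) \<times> real \<Rightarrow> real) \<Rightarrow> bool" where
  "viscosity_supersolution F T v \<longleftrightarrow>
     (\<forall>\<phi> x t p a.
        C1_on \<phi> (UNIV \<times> {0<..T}) \<longrightarrow> t \<in> {0<..T} \<longrightarrow>
        (\<forall>\<^sub>F z in at (x, t) within UNIV \<times> {0<..T}. v z - \<phi> z \<ge> v (x, t) - \<phi> (x, t)) \<longrightarrow>
        (\<phi> has_derivative (\<lambda>(h, s). p \<bullet> h + a * s)) (at (x, t) within UNIV \<times> {0<..T}) \<longrightarrow>
        a + F x t p \<ge> 0)"

text \<open>\<open>u\<^sub>t - (g\<^sup>-\<^sup>1(x) Du, Du) d\<xi>/dt\<close> is \<open>u\<^sub>t + F(x,t,Du)\<close> for the following \<open>F\<close>.\<close>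

definition eikonal ::
    "(real^'n \<Rightarrow> real^'n^'n) \<Rightarrow> real \<Rightarrow> (real \<Rightarrow> real) \<Rightarrow> real^'n \<Rightarrow> real \<Rightarrow> real^'n \<Rightarrow> real" where
  "eikonal g T \<xi> x t p =
     - (((matrix_inv (g x) *v p) \<bullet> p) * vector_derivative \<xi> (at t within {0..T}))"

definition sup_norm :: "('a \<Rightarrow> real) \<Rightarrow> 'a set \<Rightarrow> real" where
  "sup_norm u A = (SUP x\<in>A. \<bar>u x\<bar>)"

text \<open>
  For \<open>\<xi>\<close>, \<open>\<zeta>\<close> continuous on \<open>[0,T]\<close> these suprema are attained, i.e. they are maxima.
\<close>

definition Delta_plus :: "real \<Rightarrow> (real \<Rightarrow> real) \<Rightarrow> (real \<Rightarrow> real) \<Rightarrow> real" where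
  "Delta_plus T \<xi> \<zeta> = (SUP s\<in>{0..T}. \<xi> s - \<zeta> s)"

definition Delta_minus :: "real \<Rightarrow> (real \<Rightarrow> real) \<Rightarrow> (real \<Rightarrow> real) \<Rightarrow> real" where
  "Delta_minus T \<xi> \<zeta> = (SUP s\<in>{0..T}. - (\<xi> s - \<zeta> s))"

text \<open>
  The parameter \<open>\<mu>\<close> is extended real because \<open>\<mu> = \<infinity>\<close> is allowed; division of extended reals
  satisfies \<open>1 / 0 = \<infinity>\<close>, unlike division of reals.  The supremum is finite for \<open>0 < \<mu> < \<infinity>\<close>
  since moduli grow at most linearly.
\<close>

definition theta :: "(real \<Rightarrow> real) \<Rightarrow> ereal \<Rightarrow> real" where
  "theta \<omega> \<mu> = (if \<mu> = \<infinity> then 0 else (SUP r\<in>{0..}. \<omega> r - real_of_ereal \<mu> * r\<^sup>2 / 2))"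

end

theory Submission
  imports Defs
begin

text \<open>
  The distance is normalised so that the energy \<open>e = d\<^sup>2\<close> solves the eikonal equation
  \<open>(g\<^sup>-\<^sup>1(x) D\<^sub>x e, D\<^sub>x e) = e\<close> wherever it is differentiable (\<open>eikonal_e_g\<close>), and by symmetry the same
  equation in \<open>y\<close>.  Hence, as long as the denominator is positive,
  \<open>\<Phi>(x,t,y,s) = e(x,y) / (\<mu> - \<xi>\<^sub>t + \<zeta>\<^sub>s)\<close> satisfies \<open>\<Phi>\<^sub>t = (g\<^sup>-\<^sup>1 D\<^sub>x\<Phi>, D\<^sub>x\<Phi>) \<xi>'\<close> in \<open>(x,t)\<close>,
  while \<open>-\<Phi>\<close> solves the equation driven by \<open>\<zeta>\<close> in \<open>(y,s)\<close>.  So \<open>\<Phi>\<close> is an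
  ideal penalty for doubling both space and time: the terms that it contributes to the two
  viscosity inequalities cancel exactly, even at different times \<open>t \<noteq> s\<close>.

  Let \<open>A = \<parallel>u\<^sub>0\<parallel> + \<parallel>v\<^sub>0\<parallel>\<close> and let \<open>\<mu>\<close> be slightly larger than \<open>\<Delta>\<^sup>+\<close>.  Suppose that \<open>u - v\<close> exceeds
  \<open>M = sup (u\<^sub>0(x) - v\<^sub>0(y) - e(x,y)/\<mu>)\<close> somewhere, and maximise
  \<open>u(x,t) - v(y,s) - \<Phi>\<close> minus \<open>n (t-s)\<^sup>2\<close>, minus a small multiple of \<open>\<langle>x\<rangle> + \<langle>y\<rangle>\<close> which makes the maximum
  exist, minus a small multiple \<open>\<delta>\<close> of \<open>t + s\<close>.  For large \<open>n\<close> the maximum has \<open>t, s > 0\<close>, because of the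
  initial conditions and semicontinuity.  It also lies where \<open>e\<close> is smooth: a maximum principle
  (\<open>subsolution_le_initial_bound\<close>) gives \<open>u - v \<le> A\<close>, and \<open>M \<ge> -A\<close>, so that \<open>\<Phi> < 2A\<close> there; since
  \<open>\<mu> - \<xi>\<^sub>t + \<zeta>\<^sub>s\<close> is at most about \<open>\<mu> + \<Delta>\<^sup>-\<close>, this yields \<open>e < 2A(\<mu> + \<Delta>\<^sup>-) < \<Upsilon>\<^sup>2\<close>.  Adding the two viscosity
  inequalities (\<open>doubled_max_inequality\<close>) leaves \<open>2\<delta>\<close> bounded by the vanishing effect of the penalty at
  infinity, a contradiction.  This is \<open>doubled_comparison\<close>, with \<open>u - v\<close> written as \<open>u + w\<close>.

  Finally \<open>u\<^sub>0(x) - v\<^sub>0(y) \<le> sup (u\<^sub>0 - v\<^sub>0) + (\<omega>\<^sub>u \<and> \<omega>\<^sub>v)(d)\<close>, so \<open>M\<close> is bounded by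
  \<open>sup (u\<^sub>0 - v\<^sub>0) + sup (\<omega>\<^sub>u \<and> \<omega>\<^sub>v)(r) - r\<^sup>2/\<mu>\<close>.  If \<open>\<Delta>\<^sup>+ > 0\<close> then \<open>\<mu> \<le> 2\<Delta>\<^sup>+\<close> is enough to reach \<open>\<theta>\<close>; if
  \<open>\<Delta>\<^sup>+ = 0\<close> the last supremum tends to \<open>0\<close> with \<open>\<mu>\<close> (\<open>eventually_le_theta\<close>).
\<close>

section \<open>Calculus of continuously differentiable functions\<close>

lemma C1_onE:
  assumes "C1_on f S"
  obtains f' where "\<And>x. x \<in> S \<Longrightarrow> (f has_derivative blinfun_apply (f' x)) (at x within S)"
    and "continuous_on S f'"
  using assms unfolding C1_on_def by blast

lemma C1_on_imp_continuous_on: "C1_on f S \<Longrightarrow> continuous_on S f"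
  by (erule C1_onE) (rule has_derivative_continuous_on)

lemma C1_on_bounded_linear:
  assumes "bounded_linear f"
  shows "C1_on f S"
  unfolding C1_on_def
  by (rule exI[of _ "\<lambda>_. Blinfun f"])
     (auto simp: bounded_linear_Blinfun_apply[OF assms] intro: bounded_linear_imp_has_derivative assms)

lemma C1_on_const: "C1_on (\<lambda>_. c) S"
  unfolding C1_on_def by (rule exI[of _ "\<lambda>_. 0"]) (auto simp: zero_blinfun.rep_eq)

lemma C1_on_add:
  assumes "C1_on f S" "C1_on h S"
  shows "C1_on (\<lambda>x. f x + h x) S"
proof -
  obtain f' where f': "\<And>x. x \<in> S \<Longrightarrow> (f has_derivative blinfun_apply (f' x)) (at x within S)"
    "continuous_on S f'" using assms(1) unfolding C1_on_def by auto
  obtain h' where h': "\<And>x. x \<in> S \<Longrightarrow> (h has_derivative blinfun_apply (h' x)) (at x within S)"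
    "continuous_on S h'" using assms(2) unfolding C1_on_def by auto
  show ?thesis
    unfolding C1_on_def
  proof (intro exI[of _ "\<lambda>x. f' x + h' x"] conjI ballI)
    fix x assume "x \<in> S"
    then show "((\<lambda>x. f x + h x) has_derivative blinfun_apply (f' x + h' x)) (at x within S)"
      using has_derivative_add[OF f'(1) h'(1)] by (simp add: plus_blinfun.rep_eq)
  qed (intro continuous_intros f' h')
qed

lemma C1_on_mult:
  fixes f h :: "'a::real_normed_vector \<Rightarrow> real"
  assumes "C1_on f S" "C1_on h S"
  shows "C1_on (\<lambda>x. f x * h x) S"
proof -
  obtain f' where f': "\<And>x. x \<in> S \<Longrightarrow> (f has_derivative blinfun_apply (f' x)) (at x within S)"
    "continuous_on S f'" using assms(1) unfolding C1_on_def by auto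
  obtain h' where h': "\<And>x. x \<in> S \<Longrightarrow> (h has_derivative blinfun_apply (h' x)) (at x within S)"
    "continuous_on S h'" using assms(2) unfolding C1_on_def by auto
  show ?thesis
    unfolding C1_on_def
  proof (intro exI[of _ "\<lambda>x. f x *\<^sub>R h' x + h x *\<^sub>R f' x"] conjI ballI)
    fix x assume "x \<in> S"
    then show "((\<lambda>x. f x * h x) has_derivative
        blinfun_apply (f x *\<^sub>R h' x + h x *\<^sub>R f' x)) (at x within S)"
      by (auto intro!: derivative_eq_intros f' h' ext
          simp: plus_blinfun.rep_eq scaleR_blinfun.rep_eq algebra_simps)
  qed (intro continuous_intros f' h' C1_on_imp_continuous_on assms)
qed

lemma C1_on_compose:
  assumes "C1_on f U" "C1_on h S" "h ` S \<subseteq> U"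
  shows "C1_on (\<lambda>x. f (h x)) S"
proof -
  obtain f' where f': "\<And>x. x \<in> U \<Longrightarrow> (f has_derivative blinfun_apply (f' x)) (at x within U)"
    "continuous_on U f'" using assms(1) unfolding C1_on_def by auto
  obtain h' where h': "\<And>x. x \<in> S \<Longrightarrow> (h has_derivative blinfun_apply (h' x)) (at x within S)"
    "continuous_on S h'" using assms(2) unfolding C1_on_def by auto
  show ?thesis
    unfolding C1_on_def
  proof (intro exI[of _ "\<lambda>x. f' (h x) o\<^sub>L h' x"] conjI ballI)
    fix x assume x: "x \<in> S"
    then have "h x \<in> U" using assms(3) by auto
    from has_derivative_in_compose2[OF _ assms(3) x h'(1)[OF x], of f "\<lambda>y. blinfun_apply (f' y)"] f'(1)
    show "((\<lambda>x. f (h x)) has_derivative blinfun_apply (f' (h x) o\<^sub>L h' x)) (at x within S)"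
      by (simp add: blinfun_compose.rep_eq o_def)
  next
    have "continuous_on S (\<lambda>x. f' (h x))"
      by (rule continuous_on_compose2[OF f'(2) C1_on_imp_continuous_on[OF assms(2)] assms(3)])
    then show "continuous_on S (\<lambda>x. f' (h x) o\<^sub>L h' x)"
      by (intro bounded_bilinear.continuous_on[OF bounded_bilinear_blinfun_compose] h'(2))
  qed
qed

lemma C1_on_real:
  fixes f :: "real \<Rightarrow> real"
  assumes "\<And>x. x \<in> S \<Longrightarrow> (f has_real_derivative f' x) (at x within S)" "continuous_on S f'"
  shows "C1_on f S"
  unfolding C1_on_def
proof (intro exI[of _ "\<lambda>x. blinfun_scaleR_left (f' x)"] conjI ballI)
  fix x assume "x \<in> S"
  then show "(f has_derivative blinfun_apply (blinfun_scaleR_left (f' x))) (at x within S)"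
    using assms(1)[of x] by (simp add: has_field_derivative_def mult_commute_abs)
next
  show "continuous_on S (\<lambda>x. blinfun_scaleR_left (f' x))"
    by (rule bounded_linear.continuous_on[OF bounded_linear_blinfun_scaleR_left assms(2)])
qed

lemma C1_on_derivative_real:
  fixes f :: "real \<Rightarrow> 'a::real_normed_vector"
  assumes "C1_on f S"
  obtains f' where "\<And>t. t \<in> S \<Longrightarrow> (f has_vector_derivative f' t) (at t within S)"
    and "continuous_on S f'"
proof -
  obtain D where D: "\<And>x. x \<in> S \<Longrightarrow> (f has_derivative blinfun_apply (D x)) (at x within S)"
    "continuous_on S D" using assms unfolding C1_on_def by auto
  show thesis
  proof
    fix t assume "t \<in> S"
    have "blinfun_apply (D t) = (\<lambda>x. x *\<^sub>R blinfun_apply (D t) 1)"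
    proof
      fix x show "blinfun_apply (D t) x = x *\<^sub>R blinfun_apply (D t) 1"
        using blinfun.scaleR_right[of "D t" x 1] by simp
    qed
    then show "(f has_vector_derivative blinfun_apply (D t) 1) (at t within S)"
      unfolding has_vector_derivative_def using D(1)[OF \<open>t \<in> S\<close>] by simp
  next
    show "continuous_on S (\<lambda>t. blinfun_apply (D t) 1)"
      by (intro continuous_intros D(2))
  qed
qed

lemma C1_on_diff:
  fixes f h :: "'a::real_normed_vector \<Rightarrow> real"
  assumes "C1_on f S" "C1_on h S"
  shows "C1_on (\<lambda>x. f x - h x) S"
  using C1_on_add[OF assms(1) C1_on_mult[OF C1_on_const[of "-1"] assms(2)]] by simp

section \<open>Cut-off functions and the penalty at infinity\<close>

text \<open>
  Gluing two functions that agree to first order at a point; the predicate \<open>P\<close> is arbitrary, since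
  both difference quotients have the same limit.
\<close>
lemma has_real_derivative_glue:
  fixes F f1 f2 :: "real \<Rightarrow> real"
  assumes "(f1 has_real_derivative D) (at a)" "(f2 has_real_derivative D) (at a)"
    and "f1 a = F a" "f2 a = F a" "\<And>x. F x = (if P x then f1 x else f2 x)"
  shows "(F has_real_derivative D) (at a)"
proof -
  have 1: "((\<lambda>y. (f1 y - F a) / (y - a)) \<longlongrightarrow> D) (at a)" "((\<lambda>y. (f2 y - F a) / (y - a)) \<longlongrightarrow> D) (at a)"
    using assms(1-4) by (simp_all add: has_field_derivative_iff)
  have "((\<lambda>y. if P y then (f1 y - F a) / (y - a) else (f2 y - F a) / (y - a)) \<longlongrightarrow> D) (at a)"
    by (intro filterlim_If; rule filterlim_mono[OF _ order_refl inf_le1], fact 1)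
  moreover have "(\<lambda>y. if P y then (f1 y - F a) / (y - a) else (f2 y - F a) / (y - a))
     = (\<lambda>y. (F y - F a) / (y - a))"
    using assms(5) by (intro ext) presburger
  ultimately show ?thesis by (simp add: has_field_derivative_iff)
qed

lemma has_real_derivative_pos_part_square:
  "((\<lambda>r. (max 0 (r - a))\<^sup>2) has_real_derivative 2 * max 0 (x - a)) (at x)" for a x :: real
proof (cases x a rule: linorder_cases)
  case less
  have "((\<lambda>r. (0::real)) has_real_derivative 2 * max 0 (x - a)) (at x)" using less by auto
  moreover have "\<forall>\<^sub>F r in nhds x. (max 0 (r - a))\<^sup>2 = (0::real)"
    using eventually_nhds_in_open[of "{..<a}" x] less by (auto elim!: eventually_mono)
  ultimately show ?thesis using DERIV_cong_ev[OF refl _ refl] by fastforce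
next
  case greater
  have "((\<lambda>r. (r - a)\<^sup>2) has_real_derivative 2 * max 0 (x - a)) (at x)"
    using greater by (auto intro!: derivative_eq_intros)
  moreover have "\<forall>\<^sub>F r in nhds x. (max 0 (r - a))\<^sup>2 = (r - a)\<^sup>2"
    using eventually_nhds_in_open[of "{a<..}" x] greater by (auto elim!: eventually_mono)
  ultimately show ?thesis using DERIV_cong_ev[OF refl _ refl] by fastforce
next
  case equal
  show ?thesis
    by (rule has_real_derivative_glue[where P="\<lambda>r. r \<le> a" and ?f1.0="\<lambda>_. 0" and ?f2.0="\<lambda>r. (r-a)\<^sup>2"])
       (auto simp: equal max_def intro!: derivative_eq_intros)
qed

text \<open>
  The energy is \<open>C\<^sup>1\<close> only near the diagonal, while test functions have to be \<open>C\<^sup>1\<close> everywhere.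
  Composing it with \<open>smooth_cap a b\<close> repairs this: for \<open>a < b\<close> this is a \<open>C\<^sup>1\<close> function which is the
  identity up to \<open>a\<close>, constant from \<open>b\<close> on, and at least \<open>a\<close> beyond \<open>a\<close>.  Its derivative decreases
  linearly from \<open>1\<close> to \<open>0\<close> on \<open>[a, b]\<close>.
\<close>
definition smooth_cap :: "real \<Rightarrow> real \<Rightarrow> real \<Rightarrow> real" where
  "smooth_cap a b r = r - ((max 0 (r - a))\<^sup>2 - (max 0 (r - b))\<^sup>2) / (2 * (b - a))"

definition smooth_cap_deriv :: "real \<Rightarrow> real \<Rightarrow> real \<Rightarrow> real" where
  "smooth_cap_deriv a b r = 1 - (max 0 (r - a) - max 0 (r - b)) / (b - a)"

lemma has_real_derivative_smooth_cap:
  assumes "a < b"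
  shows "(smooth_cap a b has_real_derivative smooth_cap_deriv a b r) (at r)"
proof -
  have "((\<lambda>r. r - ((max 0 (r - a))\<^sup>2 - (max 0 (r - b))\<^sup>2) / (2 * (b - a))) has_real_derivative
      1 - (2 * max 0 (r - a) - 2 * max 0 (r - b)) / (2 * (b - a))) (at r)"
    by (intro DERIV_diff DERIV_cdivide has_real_derivative_pos_part_square DERIV_ident)
  moreover have "1 - (2 * max 0 (r - a) - 2 * max 0 (r - b)) / (2 * (b - a)) = smooth_cap_deriv a b r"
    unfolding smooth_cap_deriv_def by (simp only: right_diff_distrib[symmetric] mult_divide_mult_cancel_left_if) simp
  ultimately show ?thesis by (simp add: smooth_cap_def[abs_def])
qed

lemma continuous_on_smooth_cap_deriv [continuous_intros]: "a < b \<Longrightarrow> continuous_on S (smooth_cap_deriv a b)"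
  unfolding smooth_cap_deriv_def[abs_def] by (intro continuous_intros) auto

lemma continuous_on_smooth_cap: "a < b \<Longrightarrow> continuous_on S (smooth_cap a b)"
  unfolding smooth_cap_def[abs_def] by (intro continuous_intros) auto

lemma smooth_cap_eq: "r \<le> a \<Longrightarrow> a < b \<Longrightarrow> smooth_cap a b r = r"
  by (auto simp: smooth_cap_def)

lemma smooth_cap_deriv_eq_1: "r \<le> a \<Longrightarrow> a < b \<Longrightarrow> smooth_cap_deriv a b r = 1"
  by (auto simp: smooth_cap_deriv_def)

lemma smooth_cap_deriv_eq_0: "b \<le> r \<Longrightarrow> a < b \<Longrightarrow> smooth_cap_deriv a b r = 0"
  by (auto simp: smooth_cap_deriv_def)

lemma smooth_cap_const:
  assumes "b \<le> r" "a < b"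
  shows "smooth_cap a b r = (a + b) / 2"
proof -
  have "(r - a)\<^sup>2 - (r - b)\<^sup>2 = (b - a) * (2 * r - a - b)" by (simp add: power2_eq_square algebra_simps)
  then have "((r - a)\<^sup>2 - (r - b)\<^sup>2) / (2 * (b - a)) = r - (a + b) / 2"
    using assms by (simp add: field_simps)
  then show ?thesis using assms by (simp add: smooth_cap_def)
qed

lemma smooth_cap_ge:
  assumes "a \<le> r" "a < b"
  shows "a \<le> smooth_cap a b r"
proof (cases "r \<le> b")
  case True
  have "(r - a)\<^sup>2 / (2 * (b - a)) \<le> (r - a) * (b - a) / (2 * (b - a))"
    using True assms by (intro divide_right_mono) (auto simp: power2_eq_square intro: mult_left_mono)
  also have "\<dots> = (r - a) / 2" by (rule mult_divide_mult_cancel_right) (use assms in simp)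
  also have "\<dots> \<le> r - a" using assms by simp
  finally show ?thesis using True assms by (simp add: smooth_cap_def)
next
  case False
  then show ?thesis using smooth_cap_const[of b r a] assms by simp
qed

lemma smooth_cap_nonneg: "0 \<le> r \<Longrightarrow> 0 < a \<Longrightarrow> a < b \<Longrightarrow> 0 \<le> smooth_cap a b r"
  using smooth_cap_eq[of r a b] smooth_cap_ge[of a r b] by linarith

text \<open>
  The reciprocal, continued below \<open>m\<close> by its tangent at \<open>m\<close>.  It is positive and \<open>C\<^sup>1\<close> on the whole line,
  so that the coefficient \<open>1/(\<mu> - \<xi>\<^sub>t + \<zeta>\<^sub>s)\<close> makes sense for all \<open>t\<close> and \<open>s\<close>, also where the denominator
  vanishes.
\<close>
definition recip_ext :: "real \<Rightarrow> real \<Rightarrow> real" where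
  "recip_ext m r = (if r \<le> m then 1 / m - (r - m) / m\<^sup>2 else 1 / r)"

lemma has_real_derivative_recip_ext:
  assumes "0 < m"
  shows "(recip_ext m has_real_derivative - 1 / (max m r)\<^sup>2) (at r)"
proof (cases r m rule: linorder_cases)
  case less
  have "((\<lambda>r. 1 / m - (r - m) / m\<^sup>2) has_real_derivative - 1 / (max m r)\<^sup>2) (at r)"
    using less assms by (auto intro!: derivative_eq_intros simp: power2_eq_square)
  moreover have "\<forall>\<^sub>F s in nhds r. recip_ext m s = 1 / m - (s - m) / m\<^sup>2"
    using eventually_nhds_in_open[of "{..<m}" r] less by (auto simp: recip_ext_def elim!: eventually_mono)
  ultimately show ?thesis using DERIV_cong_ev[OF refl _ refl] by fastforce
next
  case greater
  have "((\<lambda>r. 1 / r) has_real_derivative - 1 / (max m r)\<^sup>2) (at r)"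
    using greater assms by (auto intro!: derivative_eq_intros simp: power2_eq_square)
  moreover have "\<forall>\<^sub>F s in nhds r. recip_ext m s = 1 / s"
    using eventually_nhds_in_open[of "{m<..}" r] greater by (auto simp: recip_ext_def elim!: eventually_mono)
  ultimately show ?thesis using DERIV_cong_ev[OF refl _ refl] by fastforce
next
  case equal
  show ?thesis
    by (rule has_real_derivative_glue[where P="\<lambda>r. r \<le> m" and
          ?f1.0="\<lambda>r. 1 / m - (r - m) / m\<^sup>2" and ?f2.0="\<lambda>r. 1 / r"])
       (use assms in \<open>auto simp: equal recip_ext_def power2_eq_square intro!: derivative_eq_intros\<close>)
qed

lemma recip_ext_pos: "0 < m \<Longrightarrow> 0 < recip_ext m r"
  unfolding recip_ext_def by (auto simp: field_simps power2_eq_square intro: add_nonneg_pos)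

lemma recip_ext_eq: "m \<le> r \<Longrightarrow> 0 < m \<Longrightarrow> recip_ext m r = 1 / r"
  by (cases "r = m") (auto simp: recip_ext_def)

lemma continuous_on_recip_ext: "0 < m \<Longrightarrow> continuous_on S (recip_ext m)"
  by (meson DERIV_isCont has_real_derivative_recip_ext continuous_at_imp_continuous_on)

text \<open>
  The penalty at infinity: it grows like the norm, and its gradient is bounded by \<open>1\<close>, so that a small
  multiple of it hardly changes a test function to first order.
\<close>
definition bracket :: "'a::real_inner \<Rightarrow> real" where
  "bracket x = sqrt (1 + x \<bullet> x)"

lemma norm_le_bracket: "norm x \<le> bracket x"
  by (simp add: bracket_def norm_eq_sqrt_inner)

lemma bracket_pos: "0 < bracket x"
  by (simp add: bracket_def add_pos_nonneg)

lemma continuous_on_bracket: "continuous_on S bracket"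
  unfolding bracket_def[abs_def] by (intro continuous_intros)

lemma has_derivative_bracket: "(bracket has_derivative (\<lambda>h. (x /\<^sub>R bracket x) \<bullet> h)) (at x)"
proof -
  have "((\<lambda>x. 1 + x \<bullet> x) has_derivative (\<lambda>h. 2 * (x \<bullet> h))) (at x)"
    by (auto intro!: derivative_eq_intros simp: inner_commute)
  moreover have pos: "0 < 1 + x \<bullet> x" by (simp add: add_pos_nonneg)
  ultimately have "((\<lambda>x. sqrt (1 + x \<bullet> x)) has_derivative
      (\<lambda>h. 2 * (x \<bullet> h) * (inverse (sqrt (1 + x \<bullet> x)) / 2))) (at x)"
    by (rule has_derivative_real_sqrt[rotated])
  moreover have "(\<lambda>h. 2 * (x \<bullet> h) * (inverse (sqrt (1 + x \<bullet> x)) / 2)) = (\<lambda>h. (x /\<^sub>R bracket x) \<bullet> h)"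
    by (rule ext) (simp add: bracket_def)
  ultimately have "((\<lambda>x. sqrt (1 + x \<bullet> x)) has_derivative (\<lambda>h. (x /\<^sub>R bracket x) \<bullet> h)) (at x)"
    by (simp only:)
  then show ?thesis by (simp only: bracket_def[abs_def])
qed

lemma norm_bracket_derivative_le: "norm (x /\<^sub>R bracket x) \<le> 1"
proof -
  have "norm x / bracket x \<le> 1" using norm_le_bracket[of x] bracket_pos[of x] by simp
  then show ?thesis using bracket_pos[of x] by (simp add: divide_inverse mult.commute)
qed

lemma C1_on_bracket: "C1_on bracket S"
  unfolding C1_on_def
proof (intro exI[of _ "\<lambda>x. blinfun_inner_right (x /\<^sub>R bracket x)"] conjI ballI)
  fix x assume "x \<in> S"
  show "(bracket has_derivative blinfun_apply (blinfun_inner_right (x /\<^sub>R bracket x))) (at x within S)"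
    using has_derivative_at_withinI[OF has_derivative_bracket] by (simp only: blinfun_inner_right.rep_eq)
next
  have "continuous_on S (\<lambda>x. x /\<^sub>R bracket x)"
  proof (intro continuous_on_scaleR continuous_on_inverse continuous_on_bracket continuous_on_id ballI)
    fix x show "bracket x \<noteq> 0" using bracket_pos[of x] by simp
  qed
  then show "continuous_on S (\<lambda>x. blinfun_inner_right (x /\<^sub>R bracket x))"
    by (rule bounded_linear.continuous_on[OF bounded_linear_blinfun_inner_right])
qed

lemma C1_on_recip_ext: "0 < m \<Longrightarrow> C1_on (recip_ext m) S"
proof (rule C1_on_real[where f'="\<lambda>r. - 1 / (max m r)\<^sup>2"])
  assume m: "0 < m"
  fix r show "(recip_ext m has_real_derivative - 1 / (max m r)\<^sup>2) (at r within S)"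
    by (rule has_field_derivative_at_within[OF has_real_derivative_recip_ext[OF m]])
next
  assume "0 < m"
  then show "continuous_on S (\<lambda>r. - 1 / (max m r)\<^sup>2)"
    by (intro continuous_on_divide continuous_on_power continuous_on_max continuous_on_const continuous_on_id) auto
qed

section \<open>Upper semicontinuous functions\<close>

definition usc_on :: "'a::topological_space set \<Rightarrow> ('a \<Rightarrow> real) \<Rightarrow> bool" where
  "usc_on S f \<longleftrightarrow> (\<forall>c. openin (top_of_set S) {z \<in> S. f z < c})"

lemma usc_on_continuous:
  assumes "continuous_on S f"
  shows "usc_on S f"
  unfolding usc_on_def
proof
  fix c
  have "openin (top_of_set S) (S \<inter> f -` {..<c})"
    using continuous_openin_preimage_gen[OF assms open_lessThan] .
  moreover have "S \<inter> f -` {..<c} = {z \<in> S. f z < c}" by auto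
  ultimately show "openin (top_of_set S) {z \<in> S. f z < c}" by simp
qed

lemma usc_on_add:
  assumes "usc_on S f" "usc_on S h"
  shows "usc_on S (\<lambda>z. f z + h z)"
  unfolding usc_on_def
proof
  fix c
  have "{z \<in> S. f z + h z < c} = (\<Union>q. {z \<in> S. f z < q} \<inter> {z \<in> S. h z < c - q})"
  proof safe
    fix z assume "z \<in> S" "f z + h z < c"
    then have "f z < (f z + (c - h z)) / 2" "h z < c - (f z + (c - h z)) / 2" by (auto simp: field_simps)
    then show "z \<in> (\<Union>q. {z \<in> S. f z < q} \<inter> {z \<in> S. h z < c - q})" using \<open>z \<in> S\<close> by blast
  qed auto
  also have "openin (top_of_set S) \<dots>"
    using assms unfolding usc_on_def by (intro openin_Union) auto
  finally show "openin (top_of_set S) {z \<in> S. f z + h z < c}" .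
qed

lemma usc_on_compose:
  assumes "usc_on U f" "continuous_on S p" "p ` S \<subseteq> U"
  shows "usc_on S (\<lambda>z. f (p z))"
  unfolding usc_on_def
proof
  fix c
  have "openin (top_of_set S) (S \<inter> p -` {z \<in> U. f z < c})"
    using continuous_openin_preimage[OF assms(2)] assms(1,3) unfolding usc_on_def by blast
  moreover have "S \<inter> p -` {z \<in> U. f z < c} = {z \<in> S. f (p z) < c}" using assms(3) by auto
  ultimately show "openin (top_of_set S) {z \<in> S. f (p z) < c}" by simp
qed

lemma usc_on_subset: "usc_on S f \<Longrightarrow> R \<subseteq> S \<Longrightarrow> usc_on R f"
  using usc_on_compose[of S f R "\<lambda>z. z"] by auto

text \<open>
  Without a maximum point, the relatively open sets \<open>{z. f z < f y}\<close> cover the compact set; the largest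
  of the finitely many values \<open>f y\<close> of a subcover would then be smaller than itself.
\<close>
lemma usc_on_attains_max_compact:
  assumes "compact S" "S \<noteq> {}" "usc_on S f"
  shows "\<exists>x\<in>S. \<forall>y\<in>S. f y \<le> f x"
proof (rule ccontr)
  assume "\<not> ?thesis"
  then have *: "\<And>x. x \<in> S \<Longrightarrow> \<exists>y\<in>S. f x < f y" by force
  let ?U = "\<lambda>y. {z \<in> S. f z < f y}"
  have "S \<subseteq> \<Union> (?U ` S)" using * by auto
  moreover have "\<forall>c\<in>?U ` S. openin (top_of_set S) c" using assms(3) by (auto simp: usc_on_def)
  ultimately obtain D where D: "D \<subseteq> ?U ` S" "finite D" "S \<subseteq> \<Union> D"
    using assms(1) unfolding compact_eq_openin_cover by meson
  then obtain Y where Y: "Y \<subseteq> S" "finite Y" "D = ?U ` Y" by (meson finite_subset_image)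
  have "Y \<noteq> {}" using D(3) assms(2) Y(3) by auto
  have "Max (f ` Y) \<in> f ` Y" using Y(2) \<open>Y \<noteq> {}\<close> by (intro Max_in) auto
  then obtain y where y: "y \<in> Y" "f y = Max (f ` Y)" by auto
  then have "y \<in> S" using Y by auto
  then obtain y' where "y' \<in> Y" "f y < f y'" using D(3) Y(3) by auto
  moreover have "f y' \<le> Max (f ` Y)" using \<open>y' \<in> Y\<close> Y(2) by auto
  ultimately show False using y(2) by auto
qed

lemma usc_on_attains_max_coercive:
  fixes S :: "'a::heine_borel set"
  assumes "closed S" "usc_on S f" "z \<in> S" "bounded {y \<in> S. f z \<le> f y}"
  shows "\<exists>x\<in>S. \<forall>y\<in>S. f y \<le> f x"
proof -
  obtain R where R: "\<And>y. y \<in> S \<Longrightarrow> f z \<le> f y \<Longrightarrow> y \<in> cball z R"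
    using assms(4) unfolding bounded_any_center[of _ z] by auto
  have "compact (S \<inter> cball z R)" using assms(1) by (simp add: closed_Int_compact)
  moreover have "z \<in> S \<inter> cball z R" using R[of z] assms(3) by auto
  moreover have "usc_on (S \<inter> cball z R) f" using usc_on_subset[OF assms(2)] by auto
  ultimately obtain x where x: "x \<in> S \<inter> cball z R" "\<And>y. y \<in> S \<inter> cball z R \<Longrightarrow> f y \<le> f x"
    using usc_on_attains_max_compact[of "S \<inter> cball z R" f] by blast
  have "f y \<le> f x" if "y \<in> S" for y
  proof (cases "f z \<le> f y")
    case True
    then show ?thesis using x R that by auto
  next
    case False
    then show ?thesis using x(2)[OF \<open>z \<in> S \<inter> cball z R\<close>] by linarith
  qed
  then show ?thesis using x by auto
qed

text \<open>
  This turns a strict bound at time \<open>0\<close>, on a bounded set of space points, into one for all small times.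
\<close>
lemma usc_on_less_near_compact:
  fixes S :: "'a::metric_space set"
  assumes "usc_on S f" "compact K" "K \<subseteq> S" "\<And>z. z \<in> K \<Longrightarrow> f z < c"
  obtains \<eta> where "0 < \<eta>" "\<And>z k. z \<in> S \<Longrightarrow> k \<in> K \<Longrightarrow> dist k z < \<eta> \<Longrightarrow> f z < c"
proof -
  obtain U where U: "open U" "{z \<in> S. f z < c} = S \<inter> U"
    using assms(1) unfolding usc_on_def openin_open by meson
  have "K \<subseteq> U" using assms(3,4) U(2) by blast
  then obtain \<eta> where "0 < \<eta>" "(\<Union>x\<in>K. ball x \<eta>) \<subseteq> U"
    using compact_subset_open_imp_ball_epsilon_subset[OF assms(2) U(1)] by metis
  with U(2) show thesis by (intro that[of \<eta>]) fastforce+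
qed

section \<open>Paths, length and the distance of a Riemannian metric\<close>

text \<open>
  The velocity is kept as an explicit parameter, so that lengths are integrals of an explicit
  continuous function.
\<close>
definition C1_path :: "(real \<Rightarrow> 'a::real_normed_vector) \<Rightarrow> (real \<Rightarrow> 'a) \<Rightarrow> real \<Rightarrow> real \<Rightarrow> bool" where
  "C1_path \<gamma> \<gamma>' a b \<longleftrightarrow> (\<forall>t\<in>{a..b}. (\<gamma> has_vector_derivative \<gamma>' t) (at t within {a..b}))
     \<and> continuous_on {a..b} \<gamma>'"

lemma C1_path_continuous_on: "C1_path \<gamma> \<gamma>' a b \<Longrightarrow> continuous_on {a..b} \<gamma>"
  unfolding C1_path_def by (meson continuous_on_vector_derivative)

lemma C1_path_subpath:
  assumes "C1_path \<gamma> \<gamma>' a b" "a \<le> c" "d \<le> b"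
  shows "C1_path \<gamma> \<gamma>' c d"
proof -
  have "{c..d} \<subseteq> {a..b}" using assms by auto
  then show ?thesis using assms(1) unfolding C1_path_def
    by (meson continuous_on_subset has_vector_derivative_within_subset subsetD)
qed

lemma C1_path_imp_C1_on:
  assumes "C1_path \<gamma> \<gamma>' a b"
  shows "C1_on \<gamma> {a..b}"
  unfolding C1_on_def
proof (intro exI[of _ "\<lambda>x. blinfun_scaleR_left (\<gamma>' x)"] conjI ballI)
  fix x assume "x \<in> {a..b}"
  then show "(\<gamma> has_derivative blinfun_apply (blinfun_scaleR_left (\<gamma>' x))) (at x within {a..b})"
    using assms by (simp add: C1_path_def has_vector_derivative_def)
next
  show "continuous_on {a..b} (\<lambda>x. blinfun_scaleR_left (\<gamma>' x))"
    using assms by (intro bounded_linear.continuous_on[OF bounded_linear_blinfun_scaleR_left]) (simp add: C1_path_def)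
qed

lemma C1_on_imp_C1_path:
  assumes "C1_on \<gamma> {a..b}"
  obtains \<gamma>' where "C1_path \<gamma> \<gamma>' a b"
  using C1_on_derivative_real[OF assms] unfolding C1_path_def by metis

lemma C1_path_line: "C1_path (\<lambda>t. x + t *\<^sub>R w) (\<lambda>_. w) a b"
  unfolding C1_path_def by (auto intro!: derivative_eq_intros)

lemma C1_path_join:
  assumes "C1_path \<gamma> \<gamma>' 0 1" "C1_path \<sigma> \<sigma>' 0 1" "\<gamma> 1 = \<sigma> 0" "\<gamma>' 1 = \<sigma>' 0"
  shows "C1_path (\<lambda>t. if t \<le> 1 then \<gamma> t else \<sigma> (t - 1)) (\<lambda>t. if t \<le> 1 then \<gamma>' t else \<sigma>' (t - 1)) 0 2"
  unfolding C1_path_def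
proof (intro conjI ballI)
  fix t :: real assume t: "t \<in> {0..2}"
  have U: "{0..2} = {0..1} \<union> {1..2::real}" by auto
  have sh: "((\<lambda>t. \<sigma> (t - 1)) has_vector_derivative \<sigma>' (t - 1)) (at t within {1..2})" if "t \<in> {1..2}"
  proof -
    have "((\<lambda>t. t - 1) has_vector_derivative 1) (at t within {1..2})"
      by (auto intro!: derivative_eq_intros)
    moreover have "(\<sigma> has_vector_derivative \<sigma>' (t - 1)) (at (t - 1) within (\<lambda>t. t - 1) ` {1..2})"
      using assms(2) that unfolding C1_path_def by (auto intro: has_vector_derivative_within_subset)
    ultimately show ?thesis using vector_diff_chain_within by (fastforce simp: o_def)
  qed
  have "((\<lambda>t. if t \<in> {0..1} then \<gamma> t else \<sigma> (t - 1)) has_vector_derivative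
     (if t \<in> {0..1} then \<gamma>' t else \<sigma>' (t - 1))) (at t within {0..2})"
    using t assms sh U
    by (intro has_vector_derivative_If_within_closures[where T="{1..2}"]) (auto simp: C1_path_def Un_absorb2 insert_absorb)
  then have "((\<lambda>t. if t \<le> 1 then \<gamma> t else \<sigma> (t - 1)) has_vector_derivative
     (if t \<in> {0..1} then \<gamma>' t else \<sigma>' (t - 1))) (at t within {0..2})"
    by (rule has_vector_derivative_transform[rotated 2]) (use t in auto)
  then show "((\<lambda>t. if t \<le> 1 then \<gamma> t else \<sigma> (t - 1)) has_vector_derivative
     (if t \<le> 1 then \<gamma>' t else \<sigma>' (t - 1))) (at t within {0..2})"
    using t by (simp split: if_splits)
next
  have "continuous_on ({0..1} \<union> {1..2::real}) (\<lambda>t. if t \<le> 1 then \<gamma>' t else \<sigma>' (t - 1))"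
    using assms unfolding C1_path_def
    by (intro continuous_on_If) (auto intro!: continuous_on_compose2[of "{0..1}" \<sigma>'] continuous_intros)
  moreover have "{0..1} \<union> {1..2::real} = {0..2}" by auto
  ultimately show "continuous_on {0..2} (\<lambda>t. if t \<le> 1 then \<gamma>' t else \<sigma>' (t - 1))" by simp
qed

lemma bounded_bilinear_matrix_vector_mult:
  "bounded_bilinear (\<lambda>(A::real^'n^'m) (w::real^'n). A *v w)"
  unfolding bilinear_conv_bounded_bilinear[symmetric] bilinear_def
  by (auto intro!: linearI simp: algebra_simps scaleR_matrix_vector_assoc)

locale elliptic_metric =
  fixes g :: "real^'n \<Rightarrow> real^'n^'n" and C :: real
  assumes continuous_on_g: "continuous_on UNIV g"
    and symmetric_g: "transpose (g x) = g x"
    and C_pos: "0 < C"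
    and lower_bound: "1 / C * (norm w)\<^sup>2 \<le> (g x *v w) \<bullet> w"
    and upper_bound: "(g x *v w) \<bullet> w \<le> C * (norm w)\<^sup>2"
begin

definition gnorm :: "real^'n \<Rightarrow> real^'n \<Rightarrow> real" where
  "gnorm z w = sqrt ((g z *v w) \<bullet> w)"

lemma inner_nonneg: "0 \<le> (g z *v w) \<bullet> w"
  using lower_bound[of w z] C_pos by (smt (verit) divide_nonneg_nonneg mult_nonneg_nonneg zero_le_power2)

lemma gnorm_square: "(gnorm z w)\<^sup>2 = (g z *v w) \<bullet> w"
  by (simp add: gnorm_def inner_nonneg)

lemma gnorm_nonneg: "0 \<le> gnorm z w"
  by (simp add: gnorm_def inner_nonneg)

lemma gnorm_scaleR: "gnorm z (c *\<^sub>R w) = \<bar>c\<bar> * gnorm z w"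
  by (simp add: gnorm_def matrix_vector_mult_scaleR mult.assoc[symmetric] real_sqrt_mult)

lemma gnorm_le: "gnorm z w \<le> sqrt C * norm w"
  unfolding gnorm_def using upper_bound[of z w] real_sqrt_le_mono by (fastforce simp: real_sqrt_mult)

lemma norm_le_gnorm: "norm w \<le> sqrt C * gnorm z w"
proof -
  have "(norm w)\<^sup>2 \<le> C * ((g z *v w) \<bullet> w)" using lower_bound[of w z] C_pos by (simp add: field_simps)
  then have "sqrt ((norm w)\<^sup>2) \<le> sqrt (C * ((g z *v w) \<bullet> w))" by (rule real_sqrt_le_mono)
  then show ?thesis by (simp add: gnorm_def real_sqrt_mult)
qed

lemma continuous_on_gnorm [continuous_intros]:
  assumes "continuous_on S \<gamma>" "continuous_on S w"
  shows "continuous_on S (\<lambda>t. gnorm (\<gamma> t) (w t))"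
proof -
  have "continuous_on S (\<lambda>t. g (\<gamma> t))"
    using continuous_on_compose2[OF continuous_on_g assms(1)] by auto
  then show ?thesis unfolding gnorm_def
    by (intro continuous_intros bounded_bilinear.continuous_on[OF bounded_bilinear_matrix_vector_mult] assms)
qed

text \<open>
  The norms at nearby points are comparable with constants close to \<open>1\<close>, uniformly in the vector.  This
  allows the metric to be treated as constant along short paths.
\<close>
lemma gnorm_near:
  assumes "0 < \<eta>" "\<eta> < 1"
  obtains r where "0 < r" "\<And>z w. dist z x < r \<Longrightarrow> (1 - \<eta>) * gnorm x w \<le> gnorm z w"
    "\<And>z w. dist z x < r \<Longrightarrow> gnorm z w \<le> (1 + \<eta>) * gnorm x w"
proof -
  obtain K where K: "0 < K" "\<And>A (w::real^'n). norm ((A::real^'n^'n) *v w) \<le> norm A * norm w * K"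
    using bounded_bilinear.pos_bounded[OF bounded_bilinear_matrix_vector_mult] by metis
  have "0 < \<eta> / (K * C)" using assms K(1) C_pos by simp
  then obtain r where r: "0 < r" "\<And>z. dist z x < r \<Longrightarrow> dist (g z) (g x) < \<eta> / (K * C)"
    using continuous_on_g unfolding continuous_on_iff by (metis UNIV_I)
  have key: "\<bar>(gnorm z w)\<^sup>2 - (gnorm x w)\<^sup>2\<bar> \<le> \<eta> * (gnorm x w)\<^sup>2" if "dist z x < r" for z w
  proof -
    have "\<bar>(gnorm z w)\<^sup>2 - (gnorm x w)\<^sup>2\<bar> = \<bar>((g z - g x) *v w) \<bullet> w\<bar>"
      by (simp add: gnorm_square matrix_vector_mult_diff_rdistrib inner_diff_left)
    also have "\<dots> \<le> norm ((g z - g x) *v w) * norm w" by (rule Cauchy_Schwarz_ineq2)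
    also have "\<dots> \<le> (norm (g z - g x) * norm w * K) * norm w" by (intro mult_right_mono K) auto
    also have "\<dots> = norm (g z - g x) * (K * (norm w)\<^sup>2)" by (simp add: power2_eq_square)
    also have "\<dots> \<le> \<eta> / (K * C) * (K * (norm w)\<^sup>2)"
      using r(2)[OF that] K(1) by (intro mult_right_mono) (auto simp: dist_norm)
    also have "\<dots> = \<eta> * (1 / C * (norm w)\<^sup>2)" using K(1) by simp
    also have "\<dots> \<le> \<eta> * (gnorm x w)\<^sup>2"
      unfolding gnorm_square using assms by (intro mult_left_mono lower_bound) auto
    finally show ?thesis .
  qed
  show thesis
  proof
    fix z w assume z: "dist z x < r"
    have "(1 - \<eta>) * (1 - \<eta>) \<le> (1 - \<eta>) * 1" using assms by (intro mult_left_mono) auto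
    from mult_right_mono[OF this, of "(gnorm x w)\<^sup>2"]
    have "((1 - \<eta>) * gnorm x w)\<^sup>2 \<le> (1 - \<eta>) * (gnorm x w)\<^sup>2"
      by (simp add: power2_eq_square mult_ac)
    also have "\<dots> \<le> (gnorm z w)\<^sup>2" using key[OF z, of w] by (simp add: algebra_simps)
    finally show "(1 - \<eta>) * gnorm x w \<le> gnorm z w" using gnorm_nonneg power2_le_imp_le by blast
    have "(gnorm z w)\<^sup>2 \<le> (1 + \<eta>) * (gnorm x w)\<^sup>2" using key[OF z, of w] by (simp add: algebra_simps)
    also have "\<dots> \<le> ((1 + \<eta>) * gnorm x w)\<^sup>2"
    proof -
      have "(1 + \<eta>) * 1 \<le> (1 + \<eta>) * (1 + \<eta>)" using assms by (intro mult_left_mono) auto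
      from mult_right_mono[OF this, of "(gnorm x w)\<^sup>2"] show ?thesis
        by (simp add: power2_eq_square mult_ac)
    qed
    finally show "gnorm z w \<le> (1 + \<eta>) * gnorm x w"
      by (rule power2_le_imp_le) (use assms gnorm_nonneg in auto)
  qed (fact r(1))
qed

definition len :: "(real \<Rightarrow> real^'n) \<Rightarrow> (real \<Rightarrow> real^'n) \<Rightarrow> real \<Rightarrow> real \<Rightarrow> real" where
  "len \<gamma> \<gamma>' a b = integral {a..b} (\<lambda>t. 1/2 * gnorm (\<gamma> t) (\<gamma>' t))"

lemma C1_path_continuous_on_speed:
  "C1_path \<gamma> \<gamma>' a b \<Longrightarrow> continuous_on {a..b} (\<lambda>t. 1/2 * gnorm (\<gamma> t) (\<gamma>' t))"
  using C1_path_continuous_on[of \<gamma> \<gamma>' a b]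
  by (intro continuous_on_mult continuous_on_const continuous_on_gnorm) (simp_all add: C1_path_def)

lemma len_nonneg: "0 \<le> len \<gamma> \<gamma>' a b"
  unfolding len_def by (cases "(\<lambda>t. 1/2 * gnorm (\<gamma> t) (\<gamma>' t)) integrable_on {a..b}")
    (auto intro!: integral_nonneg gnorm_nonneg simp: not_integrable_integral)

lemma len_split:
  assumes "C1_path \<gamma> \<gamma>' a b" "a \<le> c" "c \<le> b"
  shows "len \<gamma> \<gamma>' a c + len \<gamma> \<gamma>' c b = len \<gamma> \<gamma>' a b"
  unfolding len_def
  by (rule Henstock_Kurzweil_Integration.integral_combine[OF assms(2,3)])
     (rule integrable_continuous_real[OF C1_path_continuous_on_speed[OF assms(1)]])

lemma len_eq_g_length:
  assumes "C1_path \<gamma> \<gamma>' 0 1"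
  shows "g_length g \<gamma> = len \<gamma> \<gamma>' 0 1"
  unfolding g_length_def len_def
proof (rule integral_cong)
  fix t :: real assume t: "t \<in> {0..1}"
  then have "vector_derivative \<gamma> (at t within {0..1}) = \<gamma>' t"
    using assms by (intro vector_derivative_within_closed_interval) (auto simp: C1_path_def)
  then show "1/2 * sqrt ((g (\<gamma> t) *v vector_derivative \<gamma> (at t within {0..1})) \<bullet>
      vector_derivative \<gamma> (at t within {0..1})) = 1/2 * gnorm (\<gamma> t) (\<gamma>' t)"
    by (simp add: gnorm_def)
qed

lemma bdd_below_lengths: "bdd_below {g_length g \<gamma> | \<gamma>. C1_on \<gamma> {0..1} \<and> \<gamma> 0 = x \<and> \<gamma> 1 = y}"
proof (rule bdd_belowI[of _ 0])
  fix l assume "l \<in> {g_length g \<gamma> | \<gamma>. C1_on \<gamma> {0..1} \<and> \<gamma> 0 = x \<and> \<gamma> 1 = y}"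
  then obtain \<gamma> where "l = g_length g \<gamma>" "C1_on \<gamma> {0..1}" by auto
  moreover from this obtain \<gamma>' where "C1_path \<gamma> \<gamma>' 0 1" using C1_on_imp_C1_path by blast
  ultimately show "0 \<le> l" using len_eq_g_length len_nonneg by metis
qed

lemma d_g_le_len_unit:
  assumes "C1_path \<gamma> \<gamma>' 0 1"
  shows "d_g g (\<gamma> 0) (\<gamma> 1) \<le> len \<gamma> \<gamma>' 0 1"
  unfolding d_g_def
proof (rule cInf_lower[OF _ bdd_below_lengths], unfold mem_Collect_eq, intro exI[of _ \<gamma>] conjI refl)
  show "len \<gamma> \<gamma>' 0 1 = g_length g \<gamma>" using len_eq_g_length[OF assms] by simp
qed (rule C1_path_imp_C1_on[OF assms])

lemma almost_minimizing_path:
  assumes "0 < \<epsilon>"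
  obtains \<gamma> \<gamma>' where "C1_path \<gamma> \<gamma>' 0 1" "\<gamma> 0 = x" "\<gamma> 1 = y" "len \<gamma> \<gamma>' 0 1 < d_g g x y + \<epsilon>"
proof -
  let ?L = "{g_length g \<gamma> | \<gamma>. C1_on \<gamma> {0..1} \<and> \<gamma> 0 = x \<and> \<gamma> 1 = y}"
  have "C1_on (\<lambda>t. x + t *\<^sub>R (y - x)) {0..1}" by (rule C1_path_imp_C1_on[OF C1_path_line])
  then have "?L \<noteq> {}" by (auto intro!: exI[of _ "\<lambda>t. x + t *\<^sub>R (y - x)"])
  moreover have "Inf ?L < d_g g x y + \<epsilon>" unfolding d_g_def using assms by simp
  ultimately obtain l where "l \<in> ?L" "l < d_g g x y + \<epsilon>"
    by (meson cInf_lessD)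
  then obtain \<gamma> where \<gamma>: "C1_on \<gamma> {0..1}" "\<gamma> 0 = x" "\<gamma> 1 = y" "g_length g \<gamma> < d_g g x y + \<epsilon>" by auto
  obtain \<gamma>' where path: "C1_path \<gamma> \<gamma>' 0 1" using C1_on_imp_C1_path[OF \<gamma>(1)] .
  show thesis by (rule that[OF path \<gamma>(2,3)]) (use \<gamma>(4) len_eq_g_length[OF path] in simp)
qed

lemma d_g_nonneg: "0 \<le> d_g g x y"
proof (rule field_le_epsilon)
  fix e :: real assume "0 < e"
  then obtain \<gamma> \<gamma>' where "len \<gamma> \<gamma>' 0 1 < d_g g x y + e" using almost_minimizing_path by metis
  then show "0 \<le> d_g g x y + e" using len_nonneg[of \<gamma> \<gamma>' 0 1] by linarith
qed

text \<open>
  Reparametrising by \<open>3t\<^sup>2 - 2t\<^sup>3\<close> makes a path stop at both ends.  Two such paths can be joined into one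
  that is still \<open>C\<^sup>1\<close>, as the triangle inequality requires; the same substitution moves any parameter
  interval to \<open>[0, 1]\<close>.
\<close>
lemma smoothstep_reparametrization:
  assumes "C1_path \<gamma> \<gamma>' a b" "a \<le> b"
  obtains \<sigma> \<sigma>' where "C1_path \<sigma> \<sigma>' 0 1" "\<sigma> 0 = \<gamma> a" "\<sigma> 1 = \<gamma> b" "\<sigma>' 0 = 0" "\<sigma>' 1 = 0"
    "len \<sigma> \<sigma>' 0 1 = len \<gamma> \<gamma>' a b"
proof -
  define s where "s t = a + (b - a) * (3 * t\<^sup>2 - 2 * t^3)" for t :: real
  define s' where "s' t = (b - a) * (6 * t * (1 - t))" for t :: real
  have s: "(s has_real_derivative s' t) (at t within S)" for t S
    unfolding s_def[abs_def] s'_def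
    by (auto intro!: derivative_eq_intros simp: power2_eq_square algebra_simps)
  have s'_nonneg: "0 \<le> s' t" if "t \<in> {0..1}" for t using that assms(2) by (simp add: s'_def)
  have s_mono: "s t \<le> s t'" if "0 \<le> t" "t \<le> t'" "t' \<le> 1" for t t'
  proof (rule DERIV_nonneg_imp_nondecreasing[OF that(2)])
    fix x assume "t \<le> x" "x \<le> t'"
    then show "\<exists>y. (s has_real_derivative y) (at x) \<and> 0 \<le> y" using that by (intro exI[of _ "s' x"] conjI s s'_nonneg) auto
  qed
  have s01: "s 0 = a" "s 1 = b" by (simp_all add: s_def)
  have s_img: "s ` {0..1} \<subseteq> {a..b}"
  proof
    fix r assume "r \<in> s ` {0..1}"
    then obtain t where "0 \<le> t" "t \<le> 1" "r = s t" by auto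
    then show "r \<in> {a..b}" using s_mono[of 0 t] s_mono[of t 1] s01 by simp
  qed
  define \<sigma> where "\<sigma> = \<gamma> \<circ> s"
  define \<sigma>' where "\<sigma>' t = s' t *\<^sub>R \<gamma>' (s t)" for t
  have s_cont: "continuous_on {0..1} s" using s DERIV_continuous_on by blast
  have path: "C1_path \<sigma> \<sigma>' 0 1"
    unfolding C1_path_def
  proof (intro conjI ballI)
    fix t :: real assume t: "t \<in> {0..1}"
    have "(\<gamma> has_vector_derivative \<gamma>' (s t)) (at (s t) within s ` {0..1})"
      using assms(1) t s_img unfolding C1_path_def by (blast intro: has_vector_derivative_within_subset)
    then show "(\<sigma> has_vector_derivative \<sigma>' t) (at t within {0..1})"
      unfolding \<sigma>_def \<sigma>'_def using s
      by (intro vector_diff_chain_within) (auto simp: has_real_derivative_iff_has_vector_derivative)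
  next
    have "continuous_on {0..1} (\<lambda>t. \<gamma>' (s t))"
      using assms(1) unfolding C1_path_def by (blast intro: continuous_on_compose2[OF _ s_cont s_img])
    then show "continuous_on {0..1} \<sigma>'" unfolding \<sigma>'_def s'_def by (intro continuous_intros)
  qed
  have "((\<lambda>t. s' t *\<^sub>R (1/2 * gnorm (\<gamma> (s t)) (\<gamma>' (s t)))) has_integral
      integral {s 0..s 1} (\<lambda>t. 1/2 * gnorm (\<gamma> t) (\<gamma>' t))) {0..1}"
    using s_img s01 assms(2) s
    by (intro has_integral_substitution[OF _ _ s_img C1_path_continuous_on_speed[OF assms(1)]]) auto
  moreover have "s' t *\<^sub>R (1/2 * gnorm (\<gamma> (s t)) (\<gamma>' (s t))) = 1/2 * gnorm (\<sigma> t) (\<sigma>' t)"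
    if "t \<in> {0..1}" for t
    using s'_nonneg[OF that] by (simp add: \<sigma>_def \<sigma>'_def gnorm_scaleR)
  ultimately have "((\<lambda>t. 1/2 * gnorm (\<sigma> t) (\<sigma>' t)) has_integral len \<gamma> \<gamma>' a b) {0..1}"
    unfolding len_def s01 using has_integral_eq by (metis (no_types, lifting))
  then have "len \<sigma> \<sigma>' 0 1 = len \<gamma> \<gamma>' a b" unfolding len_def by (rule integral_unique)
  moreover have "\<sigma> 0 = \<gamma> a" "\<sigma> 1 = \<gamma> b" "\<sigma>' 0 = 0" "\<sigma>' 1 = 0"
    by (simp_all add: \<sigma>_def \<sigma>'_def s01 s'_def)
  ultimately show thesis using path that by blast
qed

lemma d_g_le_len:
  assumes "C1_path \<gamma> \<gamma>' a b" "a \<le> b"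
  shows "d_g g (\<gamma> a) (\<gamma> b) \<le> len \<gamma> \<gamma>' a b"
  using smoothstep_reparametrization[OF assms] d_g_le_len_unit by metis

lemma d_g_triangle: "d_g g x z \<le> d_g g x y + d_g g y z"
proof (rule field_le_epsilon)
  fix e :: real assume "0 < e"
  then have e: "0 < e / 2" by simp
  obtain \<gamma>0 \<gamma>0' where \<gamma>0: "C1_path \<gamma>0 \<gamma>0' 0 1" "\<gamma>0 0 = x" "\<gamma>0 1 = y" "len \<gamma>0 \<gamma>0' 0 1 < d_g g x y + e/2"
    using almost_minimizing_path[OF e] .
  obtain \<sigma>0 \<sigma>0' where \<sigma>0: "C1_path \<sigma>0 \<sigma>0' 0 1" "\<sigma>0 0 = y" "\<sigma>0 1 = z" "len \<sigma>0 \<sigma>0' 0 1 < d_g g y z + e/2"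
    using almost_minimizing_path[OF e] .
  obtain \<gamma> \<gamma>' where \<gamma>: "C1_path \<gamma> \<gamma>' 0 1" "\<gamma> 0 = x" "\<gamma> 1 = y" "\<gamma>' 1 = 0" "len \<gamma> \<gamma>' 0 1 = len \<gamma>0 \<gamma>0' 0 1"
    using smoothstep_reparametrization[OF \<gamma>0(1) zero_le_one] \<gamma>0(2,3) by metis
  obtain \<sigma> \<sigma>' where \<sigma>: "C1_path \<sigma> \<sigma>' 0 1" "\<sigma> 0 = y" "\<sigma> 1 = z" "\<sigma>' 0 = 0" "len \<sigma> \<sigma>' 0 1 = len \<sigma>0 \<sigma>0' 0 1"
    using smoothstep_reparametrization[OF \<sigma>0(1) zero_le_one] \<sigma>0(2,3) by metis
  define \<tau> where "\<tau> t = (if t \<le> 1 then \<gamma> t else \<sigma> (t - 1))" for t :: real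
  define \<tau>' where "\<tau>' t = (if t \<le> 1 then \<gamma>' t else \<sigma>' (t - 1))" for t :: real
  have path: "C1_path \<tau> \<tau>' 0 2"
    unfolding \<tau>_def \<tau>'_def using \<gamma> \<sigma> by (intro C1_path_join) auto
  have "d_g g (\<tau> 0) (\<tau> 2) \<le> len \<tau> \<tau>' 0 2" by (rule d_g_le_len[OF path]) simp
  also have "len \<tau> \<tau>' 0 2 = len \<tau> \<tau>' 0 1 + len \<tau> \<tau>' 1 2" using len_split[OF path, of 1] by simp
  also have "len \<tau> \<tau>' 0 1 = len \<gamma> \<gamma>' 0 1"
    unfolding len_def by (rule integral_cong) (auto simp: \<tau>_def \<tau>'_def)
  also have "len \<tau> \<tau>' 1 2 = len \<sigma> \<sigma>' 0 1"
  proof -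
    have "len \<sigma> \<sigma>' 0 1 = integral {0..1} ((\<lambda>t. 1/2 * gnorm (\<tau> t) (\<tau>' t)) \<circ> (\<lambda>t. t + 1))"
      unfolding len_def using \<gamma> \<sigma> by (intro integral_cong) (auto simp: \<tau>_def \<tau>'_def)
    also have "\<dots> = len \<tau> \<tau>' (0 + 1) (1 + 1)"
      unfolding len_def
      by (rule integral_shift) (use C1_path_continuous_on_speed[OF C1_path_subpath[OF path, of 1 2]] in simp)
    finally show ?thesis by simp
  qed
  finally show "d_g g x z \<le> d_g g x y + d_g g y z + e"
    using \<gamma> \<sigma> \<gamma>0(4) \<sigma>0(4) by (simp add: \<tau>_def)
qed

lemma d_g_line_le:
  assumes "\<And>t. t \<in> {0..1} \<Longrightarrow> gnorm (x + t *\<^sub>R w) w \<le> K"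
  shows "d_g g x (x + w) \<le> K / 2"
proof -
  have path: "C1_path (\<lambda>t. x + t *\<^sub>R w) (\<lambda>_. w) 0 1" by (rule C1_path_line)
  have "d_g g x (x + w) \<le> len (\<lambda>t. x + t *\<^sub>R w) (\<lambda>_. w) 0 1"
    using d_g_le_len_unit[OF path] by simp
  also have "\<dots> \<le> integral {0..1} (\<lambda>t::real. K / 2)"
    unfolding len_def using assms
    by (intro integral_le integrable_continuous_real C1_path_continuous_on_speed[OF path]) auto
  finally show ?thesis by simp
qed

lemma d_g_le_dist: "d_g g x y \<le> sqrt C / 2 * dist x y"
  using d_g_line_le[of x "y - x" "sqrt C * norm (y - x)"] gnorm_le[of _ "y - x"]
  by (simp add: dist_norm norm_minus_commute)

lemma d_g_refl: "d_g g x x = 0"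
  using d_g_le_dist[of x x] d_g_nonneg[of x x] by simp

lemma d_g_commute_le: "d_g g y x \<le> d_g g x y"
proof (rule field_le_epsilon)
  fix e :: real assume "0 < e"
  then obtain \<gamma> \<gamma>' where \<gamma>: "C1_path \<gamma> \<gamma>' 0 1" "\<gamma> 0 = x" "\<gamma> 1 = y" "len \<gamma> \<gamma>' 0 1 < d_g g x y + e"
    by (rule almost_minimizing_path)
  have path: "C1_path (\<lambda>t. \<gamma> (1 - t)) (\<lambda>t. - \<gamma>' (1 - t)) 0 1"
    unfolding C1_path_def
  proof (intro conjI ballI)
    fix t :: real assume t: "t \<in> {0..1}"
    have "((\<lambda>t. 1 - t) has_vector_derivative -1) (at t within {0..1})"
      by (auto intro!: derivative_eq_intros)
    moreover have "(\<gamma> has_vector_derivative \<gamma>' (1 - t)) (at (1 - t) within (\<lambda>t. 1 - t) ` {0..1})"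
      using \<gamma>(1) t unfolding C1_path_def by (auto intro: has_vector_derivative_within_subset)
    ultimately show "((\<lambda>t. \<gamma> (1 - t)) has_vector_derivative - \<gamma>' (1 - t)) (at t within {0..1})"
      using vector_diff_chain_within by (fastforce simp: o_def)
  next
    show "continuous_on {0..1} (\<lambda>t. - \<gamma>' (1 - t))"
      using \<gamma>(1) unfolding C1_path_def
      by (auto intro!: continuous_on_compose2[of "{0..1}" \<gamma>'] continuous_intros)
  qed
  have "len (\<lambda>t. \<gamma> (1 - t)) (\<lambda>t. - \<gamma>' (1 - t)) 0 1 = integral {0..1} (\<lambda>t. 1/2 * gnorm (\<gamma> (1 - t)) (\<gamma>' (1 - t)))"
    unfolding len_def using gnorm_scaleR[of _ "-1"] by simp
  also have "\<dots> = len \<gamma> \<gamma>' 0 1"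
  proof -
    have "integral {-1..-0} (\<lambda>t. 1/2 * gnorm (\<gamma> (- t)) (\<gamma>' (- t))) = len \<gamma> \<gamma>' 0 1"
      unfolding len_def by (rule Henstock_Kurzweil_Integration.integral_reflect_real)
    moreover have "integral {-1..0} ((\<lambda>t. 1/2 * gnorm (\<gamma> (1 - t)) (\<gamma>' (1 - t))) \<circ> (\<lambda>t. t + 1))
      = integral {-1+1..0+1} (\<lambda>t. 1/2 * gnorm (\<gamma> (1 - t)) (\<gamma>' (1 - t)))"
      by (rule integral_shift)
         (use C1_path_continuous_on_speed[OF path] gnorm_scaleR[of _ "-1"] in simp)
    ultimately show ?thesis by (simp add: o_def)
  qed
  finally have "len (\<lambda>t. \<gamma> (1 - t)) (\<lambda>t. - \<gamma>' (1 - t)) 0 1 = len \<gamma> \<gamma>' 0 1" .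
  then show "d_g g y x \<le> d_g g x y + e" using d_g_le_len_unit[OF path] \<gamma> by simp
qed

lemma d_g_commute: "d_g g x y = d_g g y x"
  using d_g_commute_le by (intro antisym)

lemma continuous_on_d_g: "continuous_on UNIV (\<lambda>(x, y). d_g g x y)"
proof -
  define L where "L = sqrt C / 2 + sqrt C / 2"
  have L: "0 \<le> L" unfolding L_def using C_pos by simp
  have one: "d_g g x y \<le> d_g g x' y' + L * dist (x, y) (x', y')" for x y x' y'
  proof -
    have "d_g g x y \<le> d_g g x x' + (d_g g x' y' + d_g g y' y)"
      using d_g_triangle[of x y x'] d_g_triangle[of x' y y'] by linarith
    moreover have "d_g g x x' \<le> sqrt C / 2 * dist (x, y) (x', y')"
      using d_g_le_dist[of x x'] dist_fst_le[of "(x, y)" "(x', y')"] C_pos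
      by (smt (verit) fst_conv mult_left_mono real_sqrt_ge_0_iff divide_nonneg_nonneg)
    moreover have "d_g g y' y \<le> sqrt C / 2 * dist (x, y) (x', y')"
      using d_g_le_dist[of y' y] dist_snd_le[of "(x, y)" "(x', y')"] C_pos
      by (smt (verit) dist_commute snd_conv mult_left_mono real_sqrt_ge_0_iff divide_nonneg_nonneg)
    ultimately show ?thesis by (simp add: L_def algebra_simps)
  qed
  have "lipschitz_on L UNIV (\<lambda>(x, y). d_g g x y)"
    unfolding lipschitz_on_def
  proof (intro conjI ballI L)
    fix p q :: "(real^'n) \<times> (real^'n)"
    show "dist (case p of (x, y) \<Rightarrow> d_g g x y) (case q of (x, y) \<Rightarrow> d_g g x y) \<le> L * dist p q"
      using one[of "fst p" "snd p" "fst q" "snd q"] one[of "fst q" "snd q" "fst p" "snd p"]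
      by (simp add: case_prod_beta dist_real_def abs_le_iff dist_commute[of q p])
  qed
  then show ?thesis by (rule lipschitz_on_continuous_on)
qed

section \<open>The dual quadratic form\<close>

definition ginv :: "real^'n \<Rightarrow> real^'n \<Rightarrow> real^'n \<Rightarrow> real" where
  "ginv x p q = (matrix_inv (g x) *v p) \<bullet> q"

lemma g_matrix_inv: "g x *v (matrix_inv (g x) *v p) = p"
proof -
  have "w = 0" if "g x *v w = 0" for w
    using lower_bound[of w x] that C_pos by (simp add: divide_le_0_iff)
  then have "\<exists>B. B ** g x = mat 1" using matrix_left_invertible_ker by blast
  then have "\<exists>A'. g x ** A' = mat 1 \<and> A' ** g x = mat 1" using matrix_left_right_inverse by blast
  then have "g x ** matrix_inv (g x) = mat 1" unfolding matrix_inv_def by (rule someI2_ex) simp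
  then show ?thesis by (simp add: matrix_vector_mul_assoc)
qed

lemma g_inner_commute: "(g x *v v) \<bullet> w = (g x *v w) \<bullet> v"
proof -
  have "(g x *v v) \<bullet> w = (v v* g x) \<bullet> w" using transpose_matrix_vector[of "g x" v] symmetric_g by simp
  also have "\<dots> = v \<bullet> (g x *v w)" by (rule dot_lmul_matrix)
  finally show ?thesis by (simp add: inner_commute)
qed

lemma g_Cauchy_Schwarz: "\<bar>(g x *v v) \<bullet> w\<bar> \<le> gnorm x v * gnorm x w"
proof (cases "v = 0")
  case False
  let ?B = "(g x *v v) \<bullet> w" and ?a = "(gnorm x v)\<^sup>2" and ?b = "(gnorm x w)\<^sup>2"
  have "0 < norm v" using False by simp
  then have "0 < sqrt C * gnorm x v" using norm_le_gnorm[of v x] by linarith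
  then have a: "0 < ?a" using C_pos by (simp add: zero_less_mult_iff)
  have "0 \<le> (gnorm x (?a *\<^sub>R w - ?B *\<^sub>R v))\<^sup>2" by simp
  also have "\<dots> = ?a * (?a * ?b - ?B\<^sup>2)"
    unfolding gnorm_square using g_inner_commute[of x w v]
    by (simp add: matrix_vector_mult_diff_distrib matrix_vector_mult_scaleR inner_diff_left inner_diff_right
        power2_eq_square algebra_simps)
  finally have "?B\<^sup>2 \<le> (gnorm x v * gnorm x w)\<^sup>2"
    using a by (simp add: zero_le_mult_iff power_mult_distrib)
  then have "\<bar>?B\<bar> \<le> \<bar>gnorm x v * gnorm x w\<bar>" by (simp add: abs_le_square_iff)
  then show ?thesis by (simp add: gnorm_nonneg)
qed (use gnorm_nonneg in simp)

lemma ginv_eq_gnorm: "ginv x p p = (gnorm x (matrix_inv (g x) *v p))\<^sup>2"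
  by (simp add: ginv_def gnorm_square g_matrix_inv inner_commute)

lemma ginv_nonneg: "0 \<le> ginv x p p"
  by (simp add: ginv_eq_gnorm)

lemma ginv_commute: "ginv x p q = ginv x q p"
  using g_inner_commute[of x "matrix_inv (g x) *v q" "matrix_inv (g x) *v p"]
  by (simp add: ginv_def g_matrix_inv inner_commute)

lemma inner_le_ginv: "\<bar>p \<bullet> w\<bar> \<le> sqrt (ginv x p p) * gnorm x w"
  using g_Cauchy_Schwarz[of x "matrix_inv (g x) *v p" w]
  by (simp add: ginv_eq_gnorm g_matrix_inv gnorm_nonneg)

lemma ginv_le: "ginv x q q \<le> C * (norm q)\<^sup>2"
proof -
  let ?n = "gnorm x (matrix_inv (g x) *v q)"
  have "?n * ?n \<le> norm (matrix_inv (g x) *v q) * norm q"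
    using norm_cauchy_schwarz[of "matrix_inv (g x) *v q" q] by (simp add: ginv_eq_gnorm[symmetric] ginv_def flip: power2_eq_square)
  also have "\<dots> \<le> (sqrt C * ?n) * norm q" by (intro mult_right_mono norm_le_gnorm) auto
  finally have "?n \<le> sqrt C * norm q"
    using gnorm_nonneg[of x "matrix_inv (g x) *v q"] C_pos
    by (cases "?n = 0") (auto simp: mult_ac mult_le_cancel_left)
  then have "?n\<^sup>2 \<le> (sqrt C * norm q)\<^sup>2" by (intro power_mono gnorm_nonneg)
  then show ?thesis using C_pos by (simp add: ginv_eq_gnorm power_mult_distrib)
qed

lemma ginv_cross_le: "2 * \<bar>ginv x p q\<bar> \<le> ginv x p p + ginv x q q"
proof -
  let ?a = "gnorm x (matrix_inv (g x) *v p)" and ?b = "gnorm x (matrix_inv (g x) *v q)"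
  have "\<bar>ginv x p q\<bar> \<le> ?a * ?b"
    using g_Cauchy_Schwarz[of x "matrix_inv (g x) *v q" "matrix_inv (g x) *v p"]
    by (simp add: g_matrix_inv ginv_def inner_commute mult.commute)
  moreover have "2 * (?a * ?b) \<le> ?a\<^sup>2 + ?b\<^sup>2" using sum_squares_bound[of ?a ?b] by simp
  ultimately show ?thesis by (simp add: ginv_eq_gnorm)
qed

text \<open>
  The Hamiltonian at the gradient of the main test function changes only by \<open>O(\<epsilon>)\<close> when \<open>\<epsilon>\<close> times the
  gradient of the penalty is added.  The cross term is split by Young's inequality, so that the bound
  involves \<open>p\<close> only through \<open>(g\<^sup>-\<^sup>1 p, p)\<close>, which the eikonal equation controls.
\<close>
lemma ginv_perturb:
  assumes "0 \<le> c" "0 \<le> \<epsilon>" "\<epsilon> \<le> 1" "norm q \<le> 1"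
  shows "\<bar>ginv x (c *\<^sub>R p + \<epsilon> *\<^sub>R q) (c *\<^sub>R p + \<epsilon> *\<^sub>R q) - c\<^sup>2 * ginv x p p\<bar>
     \<le> \<epsilon> * (c * (ginv x p p + C) + C)"
proof -
  have q: "ginv x q q \<le> C"
  proof -
    have "C * (norm q)\<^sup>2 \<le> C * 1" using assms(4) C_pos by (intro mult_left_mono) (auto simp: power_le_one)
    then show ?thesis using ginv_le[of x q] by linarith
  qed
  have "ginv x (c *\<^sub>R p + \<epsilon> *\<^sub>R q) (c *\<^sub>R p + \<epsilon> *\<^sub>R q) - c\<^sup>2 * ginv x p p
     = \<epsilon> * (c * (2 * ginv x p q) + \<epsilon> * ginv x q q)"
    using ginv_commute[of x p q]
    by (simp add: ginv_def matrix_vector_right_distrib matrix_vector_mult_scaleR inner_add_left inner_add_right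
        power2_eq_square algebra_simps)
  also have "\<bar>\<dots>\<bar> \<le> \<epsilon> * (c * (ginv x p p + C) + C)"
  proof -
    have "\<bar>c * (2 * ginv x p q)\<bar> \<le> c * (ginv x p p + C)"
      using ginv_cross_le[of x p q] q assms(1) by (simp add: abs_mult mult_left_mono)
    moreover have "\<bar>\<epsilon> * ginv x q q\<bar> \<le> C"
      using mult_mono[OF assms(3) q _ ginv_nonneg] ginv_nonneg[of x q] assms by (simp add: abs_mult)
    ultimately have "\<bar>c * (2 * ginv x p q) + \<epsilon> * ginv x q q\<bar> \<le> c * (ginv x p p + C) + C"
      by linarith
    from mult_left_mono[OF this assms(2)] show ?thesis using assms(2) by (simp add: abs_mult)
  qed
  finally show ?thesis .
qed

section \<open>The eikonal equation for the energy\<close>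

text \<open>
  With \<open>f\<close> the identity this bounds how far a path travels; with \<open>f\<close> a linear functional it bounds how
  fast that functional can decrease along a path.  The factor \<open>2\<close> undoes the \<open>1/2\<close> in the length.
\<close>
lemma path_increment_le:
  fixes f :: "real^'n \<Rightarrow> 'b::banach"
  assumes "C1_path \<gamma> \<gamma>' 0 1" "0 \<le> t" "t \<le> 1" "bounded_linear f"
    and "\<And>s. s \<in> {0..t} \<Longrightarrow> norm (f (\<gamma>' s)) \<le> K * gnorm (\<gamma> s) (\<gamma>' s)"
  shows "norm (f (\<gamma> t - \<gamma> 0)) \<le> 2 * K * len \<gamma> \<gamma>' 0 t"
proof -
  have path: "C1_path \<gamma> \<gamma>' 0 t" by (rule C1_path_subpath[OF assms(1)]) (use assms in auto)
  have "(\<gamma>' has_integral (\<gamma> t - \<gamma> 0)) {0..t}"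
    using path assms(2) unfolding C1_path_def by (intro fundamental_theorem_of_calculus) auto
  then have "(f \<circ> \<gamma>' has_integral f (\<gamma> t - \<gamma> 0)) {0..t}"
    using has_integral_linear[OF _ assms(4)] by blast
  then have "f (\<gamma> t - \<gamma> 0) = integral {0..t} (f \<circ> \<gamma>')" "f \<circ> \<gamma>' integrable_on {0..t}"
    by (simp_all add: integral_unique has_integral_integrable)
  moreover have "norm (integral {0..t} (f \<circ> \<gamma>')) \<le> integral {0..t} (\<lambda>s. 2 * K * (1/2 * gnorm (\<gamma> s) (\<gamma>' s)))"
  proof (rule Henstock_Kurzweil_Integration.integral_norm_bound_integral)
    show "(\<lambda>s. 2 * K * (1/2 * gnorm (\<gamma> s) (\<gamma>' s))) integrable_on {0..t}"
      by (intro integrable_continuous_real continuous_on_mult_left C1_path_continuous_on_speed path)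
  qed (use assms(5) calculation(2) in auto)
  ultimately show ?thesis unfolding len_def by simp
qed

text \<open>
  First half of the eikonal equation.  A short segment from \<open>x\<close> to \<open>x + h w\<close> has length at most
  \<open>(1 + \<eta>) h |w|\<^sub>g / 2\<close>, so by the triangle inequality the energy is at most
  \<open>(d + (1 + \<eta>) h |w|\<^sub>g / 2)\<^sup>2\<close> there; the derivatives at \<open>h = 0\<close> are compared.
\<close>
lemma inner_derivative_e_g_le:
  assumes "((\<lambda>x. e_g g x y) has_derivative (\<lambda>h. p \<bullet> h)) (at x)"
  shows "p \<bullet> w \<le> d_g g x y * gnorm x w"
proof -
  let ?d = "d_g g x y" and ?n = "gnorm x w"
  have step: "p \<bullet> w \<le> ?d * ((1 + \<eta>) * ?n)" if \<eta>: "0 < \<eta>" "\<eta> < 1" for \<eta>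
  proof (rule ccontr)
    assume neg: "\<not> ?thesis"
    obtain r where r: "0 < r" "\<And>z w. dist z x < r \<Longrightarrow> gnorm z w \<le> (1 + \<eta>) * gnorm x w"
      using gnorm_near[OF \<eta>] by metis
    define k where "k = (1 + \<eta>) * ?n / 2"
    have k: "0 \<le> k" using \<eta> gnorm_nonneg by (simp add: k_def)
    define F where "F h = (?d + h * k)\<^sup>2 - e_g g (x + h *\<^sub>R w) y" for h
    have "((\<lambda>h::real. x + h *\<^sub>R w) has_derivative (\<lambda>h. h *\<^sub>R w)) (at 0)"
      by (auto intro!: derivative_eq_intros)
    moreover have "((\<lambda>x. e_g g x y) has_derivative (\<lambda>h. p \<bullet> h)) (at (x + (0::real) *\<^sub>R w))" using assms by simp
    ultimately have "((\<lambda>h. e_g g (x + h *\<^sub>R w) y) has_derivative (\<lambda>h::real. p \<bullet> (h *\<^sub>R w))) (at 0)"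
      using diff_chain_at by (fastforce simp: o_def)
    then have "((\<lambda>h. e_g g (x + h *\<^sub>R w) y) has_real_derivative p \<bullet> w) (at 0)"
      by (simp add: has_field_derivative_def mult_commute_abs)
    then have "(F has_real_derivative 2 * ?d * k - p \<bullet> w) (at 0)"
      unfolding F_def by (auto intro!: derivative_eq_intros)
    moreover have "2 * ?d * k - p \<bullet> w < 0" using neg by (simp add: k_def)
    ultimately obtain \<delta> where \<delta>: "0 < \<delta>" "\<And>h. 0 < h \<Longrightarrow> h < \<delta> \<Longrightarrow> F (0 + h) < F 0"
      using DERIV_neg_dec_right by blast
    define h where "h = min (\<delta> / 2) (r / (2 * (norm w + 1)))"
    have h: "0 < h" "h < \<delta>" unfolding h_def using \<delta> r(1) by (auto intro!: divide_pos_pos add_nonneg_pos)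
    have "h * norm w < r"
    proof -
      have "h * norm w \<le> r / (2 * (norm w + 1)) * (norm w + 1)"
        unfolding h_def using r(1) by (intro mult_mono) auto
      also have "\<dots> = r / 2" using norm_ge_zero[of w] by (simp add: field_simps add_nonneg_eq_0_iff)
      finally show ?thesis using r(1) by simp
    qed
    have "d_g g x (x + h *\<^sub>R w) \<le> h * ((1 + \<eta>) * ?n) / 2"
    proof (rule d_g_line_le)
      fix t :: real assume t: "t \<in> {0..1}"
      have "norm (t *\<^sub>R h *\<^sub>R w) \<le> h * norm w"
        using t h(1) by (simp add: mult_left_le_one_le)
      then have "dist (x + t *\<^sub>R h *\<^sub>R w) x < r" using \<open>h * norm w < r\<close> by (simp add: dist_norm)
      then show "gnorm (x + t *\<^sub>R h *\<^sub>R w) (h *\<^sub>R w) \<le> h * ((1 + \<eta>) * ?n)"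
        using r(2) h(1) by (simp add: gnorm_scaleR)
    qed
    then have "d_g g (x + h *\<^sub>R w) y \<le> ?d + h * k"
      using d_g_triangle[of "x + h *\<^sub>R w" y x] d_g_commute[of x "x + h *\<^sub>R w"] by (simp add: k_def)
    then have "e_g g (x + h *\<^sub>R w) y \<le> (?d + h * k)\<^sup>2"
      unfolding e_g_def by (intro power_mono d_g_nonneg)
    then have "0 \<le> F h" by (simp add: F_def)
    moreover have "F 0 = 0" by (simp add: F_def e_g_def)
    ultimately show False using \<delta>(2)[OF h] by simp
  qed
  show ?thesis
  proof (rule field_le_epsilon)
    fix e :: real assume e: "0 < e"
    have dn: "0 \<le> ?d * ?n" by (intro mult_nonneg_nonneg d_g_nonneg gnorm_nonneg)
    define \<eta> where "\<eta> = min (1/2) (e / (?d * ?n + 1))"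
    have \<eta>: "0 < \<eta>" "\<eta> < 1" unfolding \<eta>_def using e dn by auto
    have "\<eta> * (?d * ?n) \<le> e / (?d * ?n + 1) * (?d * ?n + 1)"
      unfolding \<eta>_def using e dn by (intro mult_mono) auto
    also have "\<dots> = e" using dn by simp
    finally show "p \<bullet> w \<le> ?d * ?n + e" using step[OF \<eta>] by (simp add: algebra_simps)
  qed
qed

text \<open>
  Second half of the eikonal equation.  If the dual norm of \<open>p\<close> were less than \<open>d\<close>, the energy could
  not decrease as fast as it must along an almost minimising path from \<open>x\<close> to \<open>y\<close>: after an initial
  piece of length \<open>h\<close> the distance to \<open>y\<close> has dropped by \<open>h - h\<^sup>2\<close>, hence the energy by about \<open>2dh\<close>, while
  \<open>p\<close> applied to the displacement is at most \<open>2\<theta>'h\<close> with \<open>\<theta>' < d\<close>.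
\<close>
lemma e_g_le_ginv_derivative:
  assumes "((\<lambda>x. e_g g x y) has_derivative (\<lambda>h. p \<bullet> h)) (at x)"
  shows "e_g g x y \<le> ginv x p p"
proof (rule ccontr)
  let ?d = "d_g g x y"
  define \<theta> where "\<theta> = sqrt (ginv x p p)"
  assume "\<not> ?thesis"
  then have "\<theta> < sqrt (?d\<^sup>2)" unfolding \<theta>_def e_g_def by (intro real_sqrt_less_mono) simp
  then have \<theta>d: "\<theta> < ?d" using d_g_nonneg by simp
  have \<theta>0: "0 \<le> \<theta>" by (simp add: \<theta>_def ginv_nonneg)
  have d: "0 < ?d" using \<theta>d \<theta>0 by linarith
  \<comment> \<open>chosen so that \<open>\<theta> / (1 - \<eta>)\<close> is still less than \<open>d\<close>\<close>
  define \<eta> where "\<eta> = (?d - \<theta>) / (2 * ?d)"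
  have \<eta>: "0 < \<eta>" "\<eta> < 1" using \<theta>d \<theta>0 d by (auto simp: \<eta>_def field_simps)
  define \<theta>' where "\<theta>' = \<theta> / (1 - \<eta>)"
  have "\<theta> < ?d * (1 - \<eta>)" using d \<theta>d by (simp add: \<eta>_def field_simps)
  then have \<theta>'d: "\<theta>' < ?d" using \<eta> by (simp add: \<theta>'_def field_simps)
  obtain r where r: "0 < r" "\<And>z w. dist z x < r \<Longrightarrow> (1 - \<eta>) * gnorm x w \<le> gnorm z w"
    using gnorm_near[OF \<eta>] by metis
  have p_le: "\<bar>p \<bullet> w\<bar> \<le> \<theta>' * gnorm z w" if "dist z x < r" for z w
  proof -
    have "\<bar>p \<bullet> w\<bar> \<le> \<theta> * gnorm x w" unfolding \<theta>_def by (rule inner_le_ginv)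
    also have "\<dots> = \<theta>' * ((1 - \<eta>) * gnorm x w)" using \<eta> by (simp add: \<theta>'_def)
    also have "\<dots> \<le> \<theta>' * gnorm z w"
      using r(2)[OF that] \<theta>0 \<eta> by (intro mult_left_mono) (auto simp: \<theta>'_def)
    finally show ?thesis .
  qed
  define \<kappa> where "\<kappa> = ?d - \<theta>'"
  have \<kappa>: "0 < \<kappa>" using \<theta>'d by (simp add: \<kappa>_def)
  have "0 < \<kappa> / (2 * sqrt C)" using \<kappa> C_pos by simp
  then obtain \<delta> where \<delta>: "0 < \<delta>" "\<And>z. norm (z - x) < \<delta> \<Longrightarrow>
      norm (e_g g z y - e_g g x y - p \<bullet> (z - x)) \<le> \<kappa> / (2 * sqrt C) * norm (z - x)"
    using assms unfolding has_derivative_at_alt by metis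
  define M where "M = 2 * sqrt C"
  have M: "0 < M" using C_pos by (simp add: M_def)
  define h where "h = Min {?d / 2, 1 / 2, r / (2 * M), \<delta> / (2 * M), \<kappa> / (2 * (2 * ?d + 1))}"
  have "h \<in> {?d / 2, 1 / 2, r / (2 * M), \<delta> / (2 * M), \<kappa> / (2 * (2 * ?d + 1))}"
    unfolding h_def by (rule Min_in) auto
  then have h0: "0 < h" using d r(1) \<delta>(1) \<kappa> M by auto
  have h: "h < ?d" "h < 1" "M * h < r" "M * h < \<delta>" "(2 * ?d + 1) * h < \<kappa>"
  proof -
    have "h \<le> ?d / 2" "h \<le> 1 / 2" "h \<le> r / (2 * M)" "h \<le> \<delta> / (2 * M)" "h \<le> \<kappa> / (2 * (2 * ?d + 1))"
      unfolding h_def by (rule Min_le; simp)+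
    then show "h < ?d" "h < 1" "M * h < r" "M * h < \<delta>" "(2 * ?d + 1) * h < \<kappa>"
      using d r(1) \<delta>(1) \<kappa> M by (auto simp: field_simps)
  qed
  obtain \<gamma> \<gamma>' where \<gamma>: "C1_path \<gamma> \<gamma>' 0 1" "\<gamma> 0 = x" "\<gamma> 1 = y" "len \<gamma> \<gamma>' 0 1 < ?d + h\<^sup>2"
    using almost_minimizing_path[of "h\<^sup>2" x y] h0 by auto
  have "continuous_on {0..1} (\<lambda>t. len \<gamma> \<gamma>' 0 t)"
    unfolding len_def
    by (intro indefinite_integral_continuous_1 integrable_continuous_real C1_path_continuous_on_speed \<gamma>(1))
  moreover have "len \<gamma> \<gamma>' 0 0 \<le> h" using h0 by (simp add: len_def)
  moreover have "h \<le> len \<gamma> \<gamma>' 0 1" using d_g_le_len_unit[OF \<gamma>(1)] \<gamma>(2,3) h(1) by simp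
  \<comment> \<open>the end of the initial piece of length exactly \<open>h\<close>\<close>
  ultimately obtain \<tau> where \<tau>: "0 \<le> \<tau>" "\<tau> \<le> 1" "len \<gamma> \<gamma>' 0 \<tau> = h"
    using IVT'[of "\<lambda>t. len \<gamma> \<gamma>' 0 t" 0 h 1] by auto
  have near: "norm (\<gamma> t - x) \<le> M * h" if "0 \<le> t" "t \<le> \<tau>" for t
  proof -
    have "norm (\<gamma> t - \<gamma> 0) \<le> 2 * sqrt C * len \<gamma> \<gamma>' 0 t"
      using path_increment_le[OF \<gamma>(1), of t "\<lambda>w. w" "sqrt C"] that \<tau> norm_le_gnorm bounded_linear_ident by auto
    moreover have "len \<gamma> \<gamma>' 0 t \<le> h"
      using len_split[OF C1_path_subpath[OF \<gamma>(1), of 0 \<tau>], of t] len_nonneg[of \<gamma> \<gamma>' t \<tau>] \<tau> that by simp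
    then have "M * len \<gamma> \<gamma>' 0 t \<le> M * h" using M by (intro mult_left_mono) auto
    ultimately show ?thesis using \<gamma>(2) by (simp add: M_def)
  qed
  have p_inc: "\<bar>p \<bullet> (\<gamma> \<tau> - x)\<bar> \<le> 2 * \<theta>' * h"
    using path_increment_le[OF \<gamma>(1) \<tau>(1,2), of "\<lambda>w. p \<bullet> w" \<theta>'] p_le near h(3) \<gamma>(2) \<tau>
      bounded_linear_inner_right[of p]
    by (force simp: dist_norm)
  have "d_g g (\<gamma> \<tau>) y \<le> len \<gamma> \<gamma>' \<tau> 1"
    using d_g_le_len[OF C1_path_subpath[OF \<gamma>(1), of \<tau> 1]] \<tau> \<gamma>(3) by auto
  also have "\<dots> \<le> ?d + h\<^sup>2 - h" using len_split[OF \<gamma>(1) \<tau>(1,2)] \<tau>(3) \<gamma>(4) by linarith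
  finally have "e_g g (\<gamma> \<tau>) y \<le> (?d + h\<^sup>2 - h)\<^sup>2" unfolding e_g_def by (intro power_mono d_g_nonneg)
  also have "\<dots> = ?d\<^sup>2 - 2 * ?d * h + 2 * ?d * h\<^sup>2 + (h * (1 - h))\<^sup>2"
    by (simp add: power2_eq_square algebra_simps)
  also have "(h * (1 - h))\<^sup>2 \<le> h\<^sup>2"
    using h0 h(2) by (intro power_mono mult_left_le) auto
  finally have up: "e_g g (\<gamma> \<tau>) y - e_g g x y \<le> (- 2 * ?d + (2 * ?d + 1) * h) * h"
    by (simp add: e_g_def power2_eq_square algebra_simps)
  have "norm (\<gamma> \<tau> - x) < \<delta>" using near[OF \<tau>(1) order_refl] h(4) by linarith
  from \<delta>(2)[OF this] have "e_g g (\<gamma> \<tau>) y - e_g g x y \<ge> p \<bullet> (\<gamma> \<tau> - x) - \<kappa> / M * norm (\<gamma> \<tau> - x)"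
    by (simp add: M_def abs_le_iff)
  moreover have "\<kappa> / M * norm (\<gamma> \<tau> - x) \<le> \<kappa> / M * (M * h)"
    using near[OF \<tau>(1) order_refl] \<kappa> M by (intro mult_left_mono) auto
  moreover have "\<kappa> / M * (M * h) = \<kappa> * h" using M by simp
  ultimately have "(- 2 * \<theta>' - \<kappa>) * h \<le> (- 2 * ?d + (2 * ?d + 1) * h) * h"
    using p_inc up by (simp add: algebra_simps abs_le_iff)
  then have "- 2 * \<theta>' - \<kappa> \<le> - 2 * ?d + (2 * ?d + 1) * h" using h0 by (simp add: mult_le_cancel_right)
  then show False using h(5) \<kappa>_def by linarith
qed

lemma eikonal_e_g:
  assumes "((\<lambda>x. e_g g x y) has_derivative (\<lambda>h. p \<bullet> h)) (at x)"
  shows "ginv x p p = e_g g x y"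
proof (rule antisym[OF _ e_g_le_ginv_derivative[OF assms]])
  let ?n = "gnorm x (matrix_inv (g x) *v p)"
  have "?n * ?n = p \<bullet> (matrix_inv (g x) *v p)"
    using ginv_eq_gnorm[of x p] by (simp add: ginv_def inner_commute power2_eq_square)
  also have "\<dots> \<le> d_g g x y * ?n" by (rule inner_derivative_e_g_le[OF assms])
  finally have "?n \<le> d_g g x y"
    using gnorm_nonneg[of x "matrix_inv (g x) *v p"] d_g_nonneg[of x y]
    by (cases "?n = 0") (auto simp: mult_le_cancel_right)
  then show "ginv x p p \<le> e_g g x y"
    unfolding ginv_eq_gnorm e_g_def by (intro power_mono gnorm_nonneg)
qed

section \<open>The truncated energy\<close>

lemma open_d_g_less: "open {(x, y). d_g g x y < \<Upsilon>}"
proof -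
  have "open ((\<lambda>(x, y). d_g g x y) -` {..<\<Upsilon>})"
    by (rule open_vimage[OF open_lessThan continuous_on_d_g])
  moreover have "(\<lambda>(x, y). d_g g x y) -` {..<\<Upsilon>} = {(x, y). d_g g x y < \<Upsilon>}" by auto
  ultimately show ?thesis by simp
qed

lemma continuous_on_e_g: "continuous_on UNIV (\<lambda>(x, y). e_g g x y)"
  using continuous_on_power[OF continuous_on_d_g, of 2] by (simp add: e_g_def case_prod_beta)

lemma e_g_less_iff: "0 < \<Upsilon> \<Longrightarrow> e_g g x y < \<Upsilon>\<^sup>2 \<longleftrightarrow> d_g g x y < \<Upsilon>"
  unfolding e_g_def using d_g_nonneg[of x y] by (meson less_imp_le power2_less_imp_less power_strict_mono zero_less_numeral)

lemma e_g_nonneg: "0 \<le> e_g g x y" by (simp add: e_g_def)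

lemma e_g_refl: "e_g g x x = 0" by (simp add: e_g_def d_g_refl)

lemma e_g_commute: "e_g g x y = e_g g y x" by (simp add: e_g_def d_g_commute)

text \<open>
  The open sets \<open>{d < \<Upsilon>}\<close>, where the energy is \<open>C\<^sup>1\<close>, and \<open>{e > b}\<close>, where the truncated energy is
  constant, cover the whole space because \<open>b < \<Upsilon>\<^sup>2\<close>.
\<close>
lemma C1_on_truncated_e_g:
  assumes "0 < \<Upsilon>" "C1_on (\<lambda>(x, y). e_g g x y) {(x, y). d_g g x y < \<Upsilon>}" "a < b" "b < \<Upsilon>\<^sup>2"
  shows "C1_on (\<lambda>z. smooth_cap a b (case z of (x, y) \<Rightarrow> e_g g x y)) UNIV"
proof -
  let ?e = "\<lambda>(x, y). e_g g x y"
  let ?U = "{(x, y). d_g g x y < \<Upsilon>}" and ?V = "{z. b < ?e z}"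
  have U: "open ?U" by (rule open_d_g_less)
  have "open (?e -` {b<..})" by (rule open_vimage[OF open_greaterThan continuous_on_e_g])
  moreover have "?e -` {b<..} = ?V" by auto
  ultimately have V: "open ?V" by simp
  have UV: "?U \<union> ?V = UNIV"
  proof -
    have "z \<in> ?U \<union> ?V" for z
    proof (cases z)
      case (Pair x y)
      show ?thesis using assms(4) e_g_less_iff[OF assms(1), of x y] Pair by (cases "b < e_g g x y") auto
    qed
    then show ?thesis by blast
  qed
  obtain e' where e': "\<And>z. z \<in> ?U \<Longrightarrow> (?e has_derivative blinfun_apply (e' z)) (at z within ?U)"
    "continuous_on ?U e'"
    using assms(2) unfolding C1_on_def by auto
  define D where "D z = (if z \<in> ?U then smooth_cap_deriv a b (?e z) *\<^sub>R e' z else 0)" for z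
  have D_V: "D z = 0" if "z \<in> ?V" for z using that assms(3) by (auto simp: D_def smooth_cap_deriv_eq_0)
  show ?thesis
    unfolding C1_on_def
  proof (intro exI[of _ D] conjI ballI)
    fix z :: "(real^'n) \<times> (real^'n)"
    show "((\<lambda>z. smooth_cap a b (?e z)) has_derivative blinfun_apply (D z)) (at z within UNIV)"
    proof (cases "z \<in> ?U")
      case True
      then have "(?e has_derivative blinfun_apply (e' z)) (at z)"
        using e'(1)[OF True] at_within_open[OF True U] by simp
      moreover have "(smooth_cap a b has_derivative (\<lambda>h. h * smooth_cap_deriv a b (?e z))) (at (?e z))"
        using has_real_derivative_smooth_cap[OF assms(3), of "?e z"]
        by (simp add: has_field_derivative_def mult_commute_abs)
      ultimately have "((\<lambda>z. smooth_cap a b (?e z)) has_derivative (\<lambda>h. blinfun_apply (e' z) h * smooth_cap_deriv a b (?e z))) (at z)"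
        by (rule has_derivative_compose)
      then show ?thesis using True by (simp add: D_def scaleR_blinfun.rep_eq mult.commute)
    next
      case False
      then have z: "z \<in> ?V" using UV by blast
      have "\<forall>\<^sub>F w in nhds z. w \<in> ?V" by (rule eventually_nhds_in_open[OF V z])
      then have "\<forall>\<^sub>F w in nhds z. smooth_cap a b (?e w) = (a + b) / 2"
        by (rule eventually_mono) (use assms(3) smooth_cap_const in auto)
      then have ev: "\<forall>\<^sub>F w in at z within UNIV. (a + b) / 2 = smooth_cap a b (?e w)"
        by (simp add: eventually_at_filter eq_commute eventually_mono)
      have "((\<lambda>w. smooth_cap a b (?e w)) has_derivative (\<lambda>_. 0)) (at z within UNIV)"
        by (rule has_derivative_transform_eventually[OF has_derivative_const ev])
           (use z assms(3) smooth_cap_const[of b "?e z" a] in auto)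
      then show ?thesis using D_V[OF z] by (simp add: zero_blinfun.rep_eq)
    qed
  next
    have "continuous_on ?U (\<lambda>z. smooth_cap_deriv a b (?e z) *\<^sub>R e' z)"
      using continuous_on_subset[OF continuous_on_e_g, of ?U] continuous_on_smooth_cap_deriv[OF assms(3), of UNIV]
      by (intro continuous_on_scaleR e'(2)) (auto intro: continuous_on_compose2)
    then have "continuous_on ?U D" by (rule continuous_on_eq) (simp add: D_def)
    moreover have "continuous_on ?V D"
      by (rule continuous_on_eq[OF continuous_on_const[of _ 0]]) (simp add: D_V)
    ultimately have "continuous_on (?U \<union> ?V) D" by (rule continuous_on_open_Un[OF U V])
    then show "continuous_on UNIV D" using UV by simp
  qed
qed

lemma e_g_differentiable:
  assumes "0 < \<Upsilon>" "C1_on (\<lambda>(x, y). e_g g x y) {(x, y). d_g g x y < \<Upsilon>}" "e_g g x y < \<Upsilon>\<^sup>2"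
  obtains p where "((\<lambda>x. e_g g x y) has_derivative (\<lambda>h. p \<bullet> h)) (at x)"
proof -
  let ?U = "{(x, y). d_g g x y < \<Upsilon>}"
  have xy: "(x, y) \<in> ?U" using assms e_g_less_iff by auto
  obtain e' where "((\<lambda>(x, y). e_g g x y) has_derivative blinfun_apply e') (at (x, y) within ?U)"
    using assms(2) xy unfolding C1_on_def by blast
  then have "((\<lambda>(x, y). e_g g x y) has_derivative blinfun_apply e') (at (x, y))"
    using at_within_open[OF xy open_d_g_less] by simp
  moreover have "((\<lambda>x. (x, y)) has_derivative (\<lambda>h. (h, 0))) (at x)"
    by (auto intro!: derivative_eq_intros)
  ultimately have D: "((\<lambda>x. e_g g x y) has_derivative (\<lambda>h. blinfun_apply e' (h, 0))) (at x)"
    using has_derivative_compose[of "\<lambda>x. (x, y)" "\<lambda>h. (h, 0)" x UNIV "\<lambda>(x, y). e_g g x y"] by simp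
  then have lin: "linear (\<lambda>h. blinfun_apply e' (h, 0))" by (rule has_derivative_linear)
  define p where "p = adjoint (\<lambda>h. blinfun_apply e' (h, 0)) 1"
  have "(\<lambda>h. blinfun_apply e' (h, 0)) = (\<lambda>h. p \<bullet> h)"
    using adjoint_works[OF lin, of _ 1] by (simp add: p_def inner_commute fun_eq_iff)
  with D show thesis by (intro that[of p]) (simp only:)
qed

end

section \<open>Viscosity solutions of the eikonal equation\<close>

lemma C1_on_vector_derivative_bounded:
  fixes f :: "real \<Rightarrow> real"
  assumes "C1_on f {0..T}" "0 < T"
  obtains L where "0 \<le> L" "\<And>t. t \<in> {0..T} \<Longrightarrow> \<bar>vector_derivative f (at t within {0..T})\<bar> \<le> L"
proof -
  obtain f' where f': "\<And>t. t \<in> {0..T} \<Longrightarrow> (f has_vector_derivative f' t) (at t within {0..T})"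
    "continuous_on {0..T} f'" using C1_on_derivative_real[OF assms(1)] by metis
  have "bounded (f' ` {0..T})" by (intro compact_imp_bounded compact_continuous_image f' compact_Icc)
  then obtain L where "\<forall>r \<in> f' ` {0..T}. norm r \<le> L" unfolding bounded_iff by blast
  then have L: "\<bar>f' t\<bar> \<le> L" if "t \<in> {0..T}" for t using that by simp
  show thesis
  proof
    show "0 \<le> \<bar>L\<bar>" by simp
    fix t assume t: "t \<in> {0..T}"
    then have "vector_derivative f (at t within {0..T}) = f' t"
      using assms(2) f'(1) by (intro vector_derivative_within_closed_interval) auto
    then show "\<bar>vector_derivative f (at t within {0..T})\<bar> \<le> \<bar>L\<bar>" using L[OF t] by simp
  qed
qed

lemma C1_on_vector_derivative:
  fixes f :: "real \<Rightarrow> real"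
  assumes "C1_on f {0..T}" "0 < T" "t \<in> {0..T}"
  shows "(f has_vector_derivative vector_derivative f (at t within {0..T})) (at t within {0..T})"
proof -
  obtain f' where f': "\<And>t. t \<in> {0..T} \<Longrightarrow> (f has_vector_derivative f' t) (at t within {0..T})"
    using C1_on_derivative_real[OF assms(1)] by metis
  then show ?thesis
    using vector_derivative_within_closed_interval[OF assms(2,3) f'[OF assms(3)]] assms(3) by simp
qed

text \<open>
  The Hamiltonian is even in the gradient, so changing the sign of a solution amounts to changing the
  sign of the driving signal.  This makes the two unknowns play symmetric roles in the doubling.
\<close>
lemma supersolution_uminus:
  fixes g :: "real^'n \<Rightarrow> real^'n^'n"
  assumes "viscosity_supersolution (eikonal g T \<zeta>) T v" "C1_on \<zeta> {0..T}" "0 < T"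
  shows "viscosity_subsolution (eikonal g T (\<lambda>t. - \<zeta> t)) T (\<lambda>z. - v z)"
  unfolding viscosity_subsolution_def
proof (intro allI impI)
  fix \<phi> :: "(real^'n) \<times> real \<Rightarrow> real" and x t p a
  assume \<phi>: "C1_on \<phi> (UNIV \<times> {0<..T})" and t: "t \<in> {0<..T}"
    and max: "\<forall>\<^sub>F z in at (x, t) within UNIV \<times> {0<..T}. - v z - \<phi> z \<le> - v (x, t) - \<phi> (x, t)"
    and D: "(\<phi> has_derivative (\<lambda>(h, s). p \<bullet> h + a * s)) (at (x, t) within UNIV \<times> {0<..T})"
  have "C1_on (\<lambda>z. - \<phi> z) (UNIV \<times> {0<..T})"
    using C1_on_diff[OF C1_on_const[of 0] \<phi>] by simp
  moreover have "\<forall>\<^sub>F z in at (x, t) within UNIV \<times> {0<..T}. v z - - \<phi> z \<ge> v (x, t) - - \<phi> (x, t)"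
    using max by (rule eventually_mono) simp
  moreover have "((\<lambda>z. - \<phi> z) has_derivative (\<lambda>(h, s). (- p) \<bullet> h + (- a) * s)) (at (x, t) within UNIV \<times> {0<..T})"
    using has_derivative_minus[OF D] by (simp add: case_prod_unfold)
  ultimately have "- a + eikonal g T \<zeta> x t (- p) \<ge> 0"
    using assms(1) t unfolding viscosity_supersolution_def by blast
  moreover have "vector_derivative (\<lambda>t. - \<zeta> t) (at t within {0..T}) = - vector_derivative \<zeta> (at t within {0..T})"
    using t assms(2,3)
    by (intro vector_derivative_within_closed_interval has_vector_derivative_minus C1_on_vector_derivative) auto
  moreover have "matrix_inv (g x) *v - p = - (matrix_inv (g x) *v p)"
    using matrix_vector_mult_scaleR[of "matrix_inv (g x)" "-1" p] by simp
  ultimately show "a + eikonal g T (\<lambda>t. - \<zeta> t) x t p \<le> 0"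
    by (simp add: eikonal_def)
qed

context elliptic_metric
begin

lemma subsolution_at_max:
  assumes "viscosity_subsolution (eikonal g T \<xi>) T u" "C1_on \<phi> (UNIV \<times> {0<..T})" "t \<in> {0<..T}"
    and "\<And>z. z \<in> UNIV \<times> {0<..T} \<Longrightarrow> u z - \<phi> z \<le> u (x, t) - \<phi> (x, t)"
    and "(\<phi> has_derivative (\<lambda>(h, s). p \<bullet> h + a * s)) (at (x, t) within UNIV \<times> {0<..T})"
  shows "a \<le> ginv x p p * vector_derivative \<xi> (at t within {0..T})"
proof -
  have "\<forall>\<^sub>F z in at (x, t) within UNIV \<times> {0<..T}. u z - \<phi> z \<le> u (x, t) - \<phi> (x, t)"
    using assms(4) by (simp add: eventually_at_filter)
  then have "a + eikonal g T \<xi> x t p \<le> 0"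
    using assms(1,2,3,5) unfolding viscosity_subsolution_def by blast
  then show ?thesis by (simp add: eikonal_def ginv_def)
qed

text \<open>
  Maximum principle: at a maximum of \<open>u - \<epsilon>\<langle>x\<rangle> - \<delta>t\<close> with \<open>t > 0\<close> the equation would give
  \<open>\<delta> \<le> O(\<epsilon>)\<close>, so the maximum is attained at \<open>t = 0\<close>.
\<close>
lemma subsolution_le_initial_bound:
  fixes u :: "(real^'n) \<times> real \<Rightarrow> real"
  assumes T: "0 < T" and u: "u \<in> BUSC (UNIV \<times> {0..T})" "viscosity_subsolution (eikonal g T \<xi>) T u"
    and \<xi>: "C1_on \<xi> {0..T}" and init: "\<And>x. u (x, 0) \<le> K" and t0: "t0 \<in> {0..T}"
  shows "u (x0, t0) \<le> K"
proof (rule ccontr)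
  assume neg: "\<not> u (x0, t0) \<le> K"
  define \<sigma> where "\<sigma> = (u (x0, t0) - K) / 4"
  have \<sigma>: "0 < \<sigma>" "u (x0, t0) = K + 4 * \<sigma>" using neg by (simp_all add: \<sigma>_def field_simps)
  obtain L where L: "0 \<le> L" "\<And>t. t \<in> {0..T} \<Longrightarrow> \<bar>vector_derivative \<xi> (at t within {0..T})\<bar> \<le> L"
    using C1_on_vector_derivative_bounded[OF \<xi> T] by blast
  define \<delta> where "\<delta> = \<sigma> / (T + 1)"
  have \<delta>: "0 < \<delta>" "\<delta> * t0 \<le> \<sigma>"
  proof -
    show "0 < \<delta>" using \<sigma> T by (simp add: \<delta>_def)
    then have "\<delta> * t0 \<le> \<delta> * (T + 1)" using t0 by (intro mult_left_mono) auto
    then show "\<delta> * t0 \<le> \<sigma>" using T by (simp add: \<delta>_def)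
  qed
  define \<epsilon> where "\<epsilon> = Min {1, \<sigma> / bracket x0, \<delta> / (2 * (C * L + 1))}"
  have CL: "0 \<le> C * L" using C_pos L by simp
  have "\<epsilon> \<in> {1, \<sigma> / bracket x0, \<delta> / (2 * (C * L + 1))}" unfolding \<epsilon>_def by (rule Min_in) auto
  then have \<epsilon>0: "0 < \<epsilon>" using \<sigma> \<delta> bracket_pos[of x0] CL by auto
  have "\<epsilon> \<le> 1" "\<epsilon> \<le> \<sigma> / bracket x0" "\<epsilon> \<le> \<delta> / (2 * (C * L + 1))"
    unfolding \<epsilon>_def by (rule Min_le; simp)+
  then have \<epsilon>: "\<epsilon> \<le> 1" "\<epsilon> * bracket x0 \<le> \<sigma>" "\<epsilon> * (C * L + 1) \<le> \<delta> / 2"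
    using bracket_pos[of x0] CL by (auto simp: field_simps)
  define \<phi> where "\<phi> z = \<epsilon> * bracket (fst z) + \<delta> * snd z" for z :: "(real^'n) \<times> real"
  have \<phi>_C1: "C1_on \<phi> S" for S
    unfolding \<phi>_def
    by (intro C1_on_add C1_on_mult C1_on_const C1_on_compose[OF C1_on_bracket[of UNIV]] C1_on_bounded_linear
        bounded_linear_fst bounded_linear_snd) auto
  let ?X = "(UNIV :: (real^'n) set) \<times> {0..T}"
  obtain B where B: "\<And>z. z \<in> ?X \<Longrightarrow> \<bar>u z\<bar> \<le> B" using u(1) by (auto simp: BUSC_def bounded_iff)
  have "usc_on ?X u" using u(1) by (simp add: BUSC_def usc_on_def)
  then have "usc_on ?X (\<lambda>z. u z + - \<phi> z)"
    by (rule usc_on_add[OF _ usc_on_continuous[OF continuous_on_minus[OF C1_on_imp_continuous_on[OF \<phi>_C1]]]])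
  moreover have "bounded {z \<in> ?X. u (x0, t0) + - \<phi> (x0, t0) \<le> u z + - \<phi> z}"
  proof (rule bounded_subset)
    define R where "R = (B + B + \<phi> (x0, t0)) / \<epsilon>"
    show "bounded (cball (0::real^'n) R \<times> {0..T})" by (intro bounded_Times bounded_cball bounded_closed_interval)
    show "{z \<in> ?X. u (x0, t0) + - \<phi> (x0, t0) \<le> u z + - \<phi> z} \<subseteq> cball 0 R \<times> {0..T}"
    proof (safe, unfold mem_cball_0)
      fix x t assume t: "t \<in> {0..T}" and le: "u (x0, t0) + - \<phi> (x0, t0) \<le> u (x, t) + - \<phi> (x, t)"
      have "\<epsilon> * bracket x \<le> \<phi> (x, t)" using t \<delta> by (simp add: \<phi>_def)
      also have "\<dots> \<le> B + B + \<phi> (x0, t0)" using le B[of "(x, t)"] B[of "(x0, t0)"] t t0 by auto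
      finally have "bracket x \<le> R" using \<epsilon>0 by (simp add: R_def field_simps)
      then show "norm x \<le> R" using norm_le_bracket[of x] by linarith
    qed
  qed
  moreover have "closed ?X" by (intro closed_Times) auto
  ultimately obtain z where z: "z \<in> ?X" "\<And>z'. z' \<in> ?X \<Longrightarrow> u z' + - \<phi> z' \<le> u z + - \<phi> z"
    using usc_on_attains_max_coercive[of ?X "\<lambda>z. u z + - \<phi> z" "(x0, t0)"] t0 by auto
  obtain x t where xt: "z = (x, t)" by (cases z)
  have val: "K < u (x, t)"
  proof -
    have "K + 2 * \<sigma> \<le> u (x0, t0) - \<phi> (x0, t0)" using \<sigma> \<delta> \<epsilon> by (simp add: \<phi>_def)
    also have "\<dots> \<le> u (x, t) - \<phi> (x, t)" using z(2)[of "(x0, t0)"] t0 xt by simp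
    also have "\<dots> \<le> u (x, t)"
    proof -
      have "0 \<le> \<epsilon> * bracket x" "0 \<le> \<delta> * t" using z(1) xt \<delta> \<epsilon>0 bracket_pos[of x] by auto
      then show ?thesis by (simp add: \<phi>_def)
    qed
    finally show ?thesis using \<sigma> by linarith
  qed
  then have t: "t \<in> {0<..T}" using init[of x] z(1) xt by (cases "t = 0") auto
  have D: "(\<phi> has_derivative (\<lambda>(h, s). (\<epsilon> *\<^sub>R (x /\<^sub>R bracket x)) \<bullet> h + \<delta> * s)) (at (x, t) within UNIV \<times> {0<..T})"
  proof -
    have "((\<lambda>z. bracket (fst z)) has_derivative (\<lambda>h. (x /\<^sub>R bracket x) \<bullet> fst h)) (at (x, t) within UNIV \<times> {0<..T})"
      by (rule has_derivative_compose[of fst fst _ _ bracket])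
         (use has_derivative_bracket[of x] in \<open>auto intro!: derivative_eq_intros\<close>)
    then show ?thesis
      unfolding \<phi>_def by (auto intro!: derivative_eq_intros simp: case_prod_beta)
  qed
  have "\<delta> \<le> ginv x (\<epsilon> *\<^sub>R (x /\<^sub>R bracket x)) (\<epsilon> *\<^sub>R (x /\<^sub>R bracket x)) * vector_derivative \<xi> (at t within {0..T})"
    by (rule subsolution_at_max[OF u(2) \<phi>_C1 t _ D]) (use z(2) xt in auto)
  also have "\<dots> \<le> (\<epsilon> * C) * L"
  proof -
    have "\<bar>ginv x (0 *\<^sub>R 0 + \<epsilon> *\<^sub>R (x /\<^sub>R bracket x)) (0 *\<^sub>R 0 + \<epsilon> *\<^sub>R (x /\<^sub>R bracket x)) - 0\<^sup>2 * ginv x 0 0\<bar>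
        \<le> \<epsilon> * (0 * (ginv x 0 0 + C) + C)"
      using \<epsilon>0 \<epsilon> norm_bracket_derivative_le by (intro ginv_perturb) auto
    then have "\<bar>ginv x (\<epsilon> *\<^sub>R (x /\<^sub>R bracket x)) (\<epsilon> *\<^sub>R (x /\<^sub>R bracket x))\<bar> \<le> \<epsilon> * C" by simp
    then have "\<bar>ginv x (\<epsilon> *\<^sub>R (x /\<^sub>R bracket x)) (\<epsilon> *\<^sub>R (x /\<^sub>R bracket x))\<bar> *
        \<bar>vector_derivative \<xi> (at t within {0..T})\<bar> \<le> (\<epsilon> * C) * L"
      using L(2)[of t] t by (intro mult_mono) auto
    then show ?thesis by (simp only: abs_mult[symmetric])
  qed
  also have "\<dots> \<le> \<delta> / 2" using \<epsilon>(3) \<epsilon>0 by (simp add: algebra_simps)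
  finally show False using \<delta> by simp
qed

section \<open>Doubling of variables\<close>

text \<open>
  The viscosity inequality at a maximum, with \<open>(y, s)\<close> frozen and \<open>\<beta>\<close> the constant part of the
  denominator.  With \<open>c = 1/(\<beta> - \<xi>\<^sub>t)\<close> the time derivative of \<open>c e\<close> is \<open>c\<^sup>2 \<xi>' e\<close>, and the eikonal equation
  says that this equals \<open>(g\<^sup>-\<^sup>1 D(ce), D(ce)) \<xi>'\<close>.  Both terms drop out, and only the auxiliary penalties
  remain, with a bound that does not depend on \<open>n\<close>.
\<close>
lemma doubled_max_inequality:
  fixes u :: "(real^'n) \<times> real \<Rightarrow> real"
  assumes T: "0 < T" and u: "viscosity_subsolution (eikonal g T \<xi>) T u" and \<xi>: "C1_on \<xi> {0..T}"
    and e: "0 < \<Upsilon>" "C1_on (\<lambda>(x, y). e_g g x y) {(x, y). d_g g x y < \<Upsilon>}"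
    and ab: "0 < a" "a < b" "b < \<Upsilon>\<^sup>2" and m: "0 < m" "m \<le> \<beta> - \<xi> t" and \<epsilon>: "0 \<le> \<epsilon>" "\<epsilon> \<le> 1"
    and t: "t \<in> {0<..T}" and exy: "e_g g x y \<le> a"
    and L: "\<bar>vector_derivative \<xi> (at t within {0..T})\<bar> \<le> L"
    and max: "\<And>x' t'. t' \<in> {0<..T} \<Longrightarrow>
      u (x', t') - (recip_ext m (\<beta> - \<xi> t') * smooth_cap a b (e_g g x' y) + \<epsilon> * bracket x' + \<delta> * t' + n * (t' - s)\<^sup>2)
      \<le> u (x, t) - (recip_ext m (\<beta> - \<xi> t) * smooth_cap a b (e_g g x y) + \<epsilon> * bracket x + \<delta> * t + n * (t - s)\<^sup>2)"
  shows "\<delta> + 2 * n * (t - s) \<le> \<epsilon> * (L * ((a + C) / m + C))"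
proof -
  let ?S = "(UNIV :: (real^'n) set) \<times> {0<..T}"
  define \<phi> where "\<phi> z = recip_ext m (\<beta> - \<xi> (snd z)) * smooth_cap a b (e_g g (fst z) y) + \<epsilon> * bracket (fst z)
      + \<delta> * snd z + n * ((snd z - s) * (snd z - s))" for z :: "(real^'n) \<times> real"
  have C1_lin: "C1_on fst ?S" "C1_on snd ?S"
    by (intro C1_on_bounded_linear bounded_linear_fst bounded_linear_snd)+
  have "C1_on (\<lambda>z. \<xi> (snd z)) ?S" by (rule C1_on_compose[OF \<xi> C1_lin(2)]) auto
  then have 1: "C1_on (\<lambda>z. recip_ext m (\<beta> - \<xi> (snd z))) ?S"
    using C1_on_compose[OF C1_on_recip_ext[OF m(1), of UNIV] C1_on_diff[OF C1_on_const]] by blast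
  have "C1_on (\<lambda>z. (fst z, 0) + (0, y)) ?S"
    by (intro C1_on_add C1_on_const C1_on_bounded_linear bounded_linear_Pair bounded_linear_fst bounded_linear_zero)
  then have 2: "C1_on (\<lambda>z. smooth_cap a b (e_g g (fst z) y)) ?S"
    using C1_on_compose[OF C1_on_truncated_e_g[OF e ab(2,3)], of "\<lambda>z. (fst z, 0) + (0, y)" ?S] by simp
  have 3: "C1_on (\<lambda>z. bracket (fst z)) ?S"
    by (rule C1_on_compose[OF C1_on_bracket[of UNIV] C1_lin(1)]) auto
  have \<phi>_C1: "C1_on \<phi> ?S"
    unfolding \<phi>_def by (intro C1_on_add C1_on_mult C1_on_diff C1_on_const 1 2 3 C1_lin)

  obtain p where p: "((\<lambda>x. e_g g x y) has_derivative (\<lambda>h. p \<bullet> h)) (at x)"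
    using e_g_differentiable[OF e] exy ab by (metis le_less_trans less_trans)
  define \<xi>' where "\<xi>' = vector_derivative \<xi> (at t within {0..T})"
  define c where "c = 1 / (\<beta> - \<xi> t)"
  have c: "0 < c" "c \<le> 1 / m" using m by (auto simp: c_def frac_le)
  define q where "q = x /\<^sub>R bracket x"
  define A where "A = c\<^sup>2 * \<xi>' * e_g g x y + \<delta> + 2 * n * (t - s)"
  have D_fst: "(fst has_derivative fst) (at (x, t) within ?S)" and D_snd: "(snd has_derivative snd) (at (x, t) within ?S)"
    by (auto intro!: derivative_eq_intros)
  have D_\<xi>: "((\<lambda>z. \<xi> (snd z)) has_derivative (\<lambda>h. snd h * \<xi>')) (at (x, t) within ?S)"
  proof (rule has_derivative_in_compose[OF D_snd])
    have "(\<xi> has_derivative (\<lambda>s. s * \<xi>')) (at t within {0..T})"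
      using C1_on_vector_derivative[OF \<xi> T, of t] t by (simp add: \<xi>'_def has_vector_derivative_def)
    then show "(\<xi> has_derivative (\<lambda>s. s * \<xi>')) (at (snd (x, t)) within snd ` ?S)"
      by (auto intro: has_derivative_subset)
  qed
  have "(*) (- 1 / (max m (\<beta> - \<xi> t))\<^sup>2) = (\<lambda>s. s * (- c\<^sup>2))"
    using m by (simp add: fun_eq_iff c_def power_divide max_absorb2)
  then have "(recip_ext m has_derivative (\<lambda>s. s * (- c\<^sup>2))) (at (\<beta> - \<xi> (snd (x, t))))"
    using has_real_derivative_recip_ext[OF m(1), of "\<beta> - \<xi> t"]
    by (simp only: has_field_derivative_def snd_conv)
  from has_derivative_compose[OF has_derivative_diff[OF has_derivative_const[of \<beta>] D_\<xi>] this]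
  have D1: "((\<lambda>z. recip_ext m (\<beta> - \<xi> (snd z))) has_derivative (\<lambda>h. (0 - snd h * \<xi>') * (- c\<^sup>2))) (at (x, t) within ?S)" .
  have D_e: "((\<lambda>z. e_g g (fst z) y) has_derivative (\<lambda>h. p \<bullet> fst h)) (at (x, t) within ?S)"
    by (rule has_derivative_compose[OF D_fst, of "\<lambda>x. e_g g x y" "\<lambda>h. p \<bullet> h"]) (use p in simp)
  have "(*) 1 = (\<lambda>s::real. s)" by (simp add: fun_eq_iff)
  then have "(smooth_cap a b has_derivative (\<lambda>s. s)) (at (e_g g (fst (x, t)) y))"
    using has_real_derivative_smooth_cap[OF ab(2), of "e_g g x y"] smooth_cap_deriv_eq_1[OF exy ab(2)]
    by (simp only: has_field_derivative_def fst_conv)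
  from has_derivative_compose[OF D_e this]
  have D2: "((\<lambda>z. smooth_cap a b (e_g g (fst z) y)) has_derivative (\<lambda>h. p \<bullet> fst h)) (at (x, t) within ?S)" .
  have D3: "((\<lambda>z. bracket (fst z)) has_derivative (\<lambda>h. q \<bullet> fst h)) (at (x, t) within ?S)"
    by (rule has_derivative_compose[OF D_fst, of bracket "\<lambda>h. q \<bullet> h"]) (use has_derivative_bracket q_def in simp)
  have vals: "recip_ext m (\<beta> - \<xi> t) = c" "smooth_cap a b (e_g g x y) = e_g g x y"
    using recip_ext_eq[OF m(2,1)] smooth_cap_eq[OF exy ab(2)] by (simp_all add: c_def)
  have D: "(\<phi> has_derivative (\<lambda>(h, s). (c *\<^sub>R p + \<epsilon> *\<^sub>R q) \<bullet> h + A * s)) (at (x, t) within ?S)"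
    unfolding \<phi>_def
    by (rule has_derivative_eq_rhs, (rule derivative_intros D1 D2 D3 D_snd)+)
       (simp add: fun_eq_iff vals A_def inner_add_left algebra_simps)
  have "A \<le> ginv x (c *\<^sub>R p + \<epsilon> *\<^sub>R q) (c *\<^sub>R p + \<epsilon> *\<^sub>R q) * \<xi>'"
    unfolding \<xi>'_def
    by (rule subsolution_at_max[OF u \<phi>_C1 t _ D]) (use max in \<open>auto simp: \<phi>_def power2_eq_square\<close>)
  then have "\<delta> + 2 * n * (t - s) \<le> (ginv x (c *\<^sub>R p + \<epsilon> *\<^sub>R q) (c *\<^sub>R p + \<epsilon> *\<^sub>R q) - c\<^sup>2 * ginv x p p) * \<xi>'"
    by (simp add: A_def eikonal_e_g[OF p] algebra_simps)
  also have "\<dots> \<le> \<bar>ginv x (c *\<^sub>R p + \<epsilon> *\<^sub>R q) (c *\<^sub>R p + \<epsilon> *\<^sub>R q) - c\<^sup>2 * ginv x p p\<bar> * \<bar>\<xi>'\<bar>"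
    by (metis abs_ge_self abs_mult)
  also have "\<dots> \<le> (\<epsilon> * (c * (ginv x p p + C) + C)) * L"
    using c \<epsilon> L norm_bracket_derivative_le[of x] ginv_nonneg[of x p] C_pos
    by (intro mult_mono ginv_perturb) (auto simp: \<xi>'_def q_def)
  also have "\<dots> \<le> (\<epsilon> * ((a + C) / m + C)) * L"
  proof -
    have "c * (ginv x p p + C) \<le> 1 / m * (a + C)"
      using c exy eikonal_e_g[OF p] e_g_nonneg[of x y] C_pos m by (intro mult_mono) auto
    then show ?thesis using \<epsilon> L by (intro mult_right_mono mult_left_mono) auto
  qed
  finally show ?thesis by (simp add: mult_ac)
qed

text \<open>
  The comparison for a pair of sub-solutions driven by \<open>\<xi>\<close> and \<open>\<eta>\<close>; a super-solution \<open>v\<close> driven by \<open>\<zeta>\<close>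
  enters as \<open>w = -v\<close>, \<open>\<eta> = -\<zeta>\<close>.  The hypothesis \<open>(\<mu> + Dm) (2 (Ku + Kw)) < a\<close> confines the
  maximum to the region \<open>e \<le> a\<close> in which the truncation is invisible.
\<close>
lemma doubled_comparison:
  fixes u w :: "(real^'n) \<times> real \<Rightarrow> real"
  assumes T: "0 < T" and e: "0 < \<Upsilon>" "C1_on (\<lambda>(x, y). e_g g x y) {(x, y). d_g g x y < \<Upsilon>}"
    and \<xi>: "C1_on \<xi> {0..T}" "\<xi> 0 = 0" and \<eta>: "C1_on \<eta> {0..T}" "\<eta> 0 = 0"
    and u: "u \<in> BUSC (UNIV \<times> {0..T})" "viscosity_subsolution (eikonal g T \<xi>) T u"
    and w: "w \<in> BUSC (UNIV \<times> {0..T})" "viscosity_subsolution (eikonal g T \<eta>) T w"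
    and uK: "\<And>x. u (x, 0) \<le> Ku" and wK: "\<And>x. w (x, 0) \<le> Kw"
    and drv: "\<And>t. t \<in> {0..T} \<Longrightarrow> \<xi> t + \<eta> t \<le> Dp" "\<And>t. t \<in> {0..T} \<Longrightarrow> - Dm \<le> \<xi> t + \<eta> t"
    and \<mu>: "Dp < \<mu>" "0 < \<mu>" and ab: "0 < a" "a < b" "b < \<Upsilon>\<^sup>2"
    and K: "0 \<le> Ku + Kw" "(\<mu> + Dm) * (2 * (Ku + Kw)) < a" "- (Ku + Kw) \<le> M"
    and init: "\<And>x y. u (x, 0) + w (y, 0) - smooth_cap a b (e_g g x y) / \<mu> \<le> M"
    and t0: "t0 \<in> {0..T}"
  shows "u (x0, t0) + w (x0, t0) \<le> M"
proof (rule ccontr)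
  assume neg: "\<not> u (x0, t0) + w (x0, t0) \<le> M"
  define A where "A = Ku + Kw"
  have uw_le: "u (x, t) + w (y, s) \<le> A" if "t \<in> {0..T}" "s \<in> {0..T}" for x y t s
    using subsolution_le_initial_bound[OF T u \<xi>(1) uK that(1), of x]
      subsolution_le_initial_bound[OF T w \<eta>(1) wK that(2), of y] by (simp add: A_def)
  define \<sigma> where "\<sigma> = (u (x0, t0) + w (x0, t0) - M) / 4"
  have \<sigma>: "0 < \<sigma>" "u (x0, t0) + w (x0, t0) = M + 4 * \<sigma>" using neg by (simp_all add: \<sigma>_def field_simps)
  define m where "m = min ((\<mu> - Dp) / 2) \<mu>"
  have m: "0 < m" "m \<le> \<mu>" "m \<le> (\<mu> - Dp) / 2" using \<mu> by (auto simp: m_def min_def)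
  obtain L1 where L1: "0 \<le> L1" "\<And>t. t \<in> {0..T} \<Longrightarrow> \<bar>vector_derivative \<xi> (at t within {0..T})\<bar> \<le> L1"
    using C1_on_vector_derivative_bounded[OF \<xi>(1) T] by blast
  obtain L2 where L2: "0 \<le> L2" "\<And>t. t \<in> {0..T} \<Longrightarrow> \<bar>vector_derivative \<eta> (at t within {0..T})\<bar> \<le> L2"
    using C1_on_vector_derivative_bounded[OF \<eta>(1) T] by blast
  define Q where "Q = (a + C) / m + C"
  have Q: "0 < Q" using ab m C_pos by (simp add: Q_def add_pos_pos)
  define \<delta> where "\<delta> = \<sigma> / (2 * (T + 1))"
  have \<delta>: "0 < \<delta>" "2 * (\<delta> * t0) \<le> \<sigma>"
  proof -
    show \<delta>0: "0 < \<delta>" using \<sigma> T by (simp add: \<delta>_def)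
    have "2 * (\<delta> * t0) \<le> 2 * (\<delta> * (T + 1))" using t0 \<delta>0 by (intro mult_left_mono) auto
    also have "\<dots> = \<sigma>" using T by (simp add: \<delta>_def field_simps)
    finally show "2 * (\<delta> * t0) \<le> \<sigma>" .
  qed
  define \<epsilon> where "\<epsilon> = Min {1, \<sigma> / (2 * bracket x0), \<delta> / (2 * ((L1 + L2 + 1) * Q))}"
  have LQ: "0 < (L1 + L2 + 1) * Q" using L1(1) L2(1) Q by simp
  have "\<epsilon> \<in> {1, \<sigma> / (2 * bracket x0), \<delta> / (2 * ((L1 + L2 + 1) * Q))}" unfolding \<epsilon>_def by (rule Min_in) auto
  then have \<epsilon>0: "0 < \<epsilon>" using \<sigma> \<delta> bracket_pos[of x0] LQ by auto
  have "\<epsilon> \<le> 1" "\<epsilon> \<le> \<sigma> / (2 * bracket x0)" "\<epsilon> \<le> \<delta> / (2 * ((L1 + L2 + 1) * Q))"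
    unfolding \<epsilon>_def by (rule Min_le; simp)+
  then have \<epsilon>: "\<epsilon> \<le> 1" "2 * (\<epsilon> * bracket x0) \<le> \<sigma>" "\<epsilon> * ((L1 + L2 + 1) * Q) \<le> \<delta> / 2"
    using bracket_pos[of x0] LQ by (auto simp: pos_le_divide_eq algebra_simps)
  have \<epsilon>L: "\<epsilon> * (L1 * Q) < \<delta>" "\<epsilon> * (L2 * Q) < \<delta>"
  proof -
    have "\<epsilon> * (L1 * Q) \<le> \<epsilon> * ((L1 + L2 + 1) * Q)" "\<epsilon> * (L2 * Q) \<le> \<epsilon> * ((L1 + L2 + 1) * Q)"
      using \<epsilon>0 Q L1(1) L2(1) by (auto intro!: mult_left_mono mult_right_mono)
    then show "\<epsilon> * (L1 * Q) < \<delta>" "\<epsilon> * (L2 * Q) < \<delta>" using \<epsilon>(3) \<delta>(1) by linarith+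
  qed
  \<comment> \<open>the admissible error from replacing \<open>\<eta> s\<close> by \<open>\<eta> t\<close>: the denominator stays above \<open>m\<close>, and \<open>2A\<close> times it at most \<open>a\<close>\<close>
  define \<eta>0 where "\<eta>0 = min m ((a - (\<mu> + Dm) * (2 * A)) / (2 * A + 1))"
  have A0: "0 \<le> A" using K by (simp add: A_def)
  have gap: "0 < a - (\<mu> + Dm) * (2 * A)" using K by (simp add: A_def)
  have \<eta>0: "0 < \<eta>0" "\<eta>0 \<le> m" "\<eta>0 * (2 * A) \<le> a - (\<mu> + Dm) * (2 * A)"
  proof -
    show \<eta>00: "0 < \<eta>0" using m gap A0 by (simp add: \<eta>0_def)
    show "\<eta>0 \<le> m" by (simp add: \<eta>0_def)
    have "\<eta>0 * (2 * A) \<le> \<eta>0 * (2 * A + 1)" using \<eta>00 by simp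
    also have "\<dots> \<le> (a - (\<mu> + Dm) * (2 * A)) / (2 * A + 1) * (2 * A + 1)"
      using A0 by (intro mult_right_mono) (auto simp: \<eta>0_def)
    also have "\<dots> = a - (\<mu> + Dm) * (2 * A)" using A0 by simp
    finally show "\<eta>0 * (2 * A) \<le> a - (\<mu> + Dm) * (2 * A)" .
  qed
  have "uniformly_continuous_on {0..T} \<eta>"
    by (intro compact_uniformly_continuous C1_on_imp_continuous_on \<eta>(1)) auto
  then obtain r1 where r1: "0 < r1" "\<And>s t. s \<in> {0..T} \<Longrightarrow> t \<in> {0..T} \<Longrightarrow> dist s t < r1 \<Longrightarrow> dist (\<eta> s) (\<eta> t) < \<eta>0"
    using \<eta>0(1) unfolding uniformly_continuous_on_def by metis

  let ?X = "((UNIV :: (real^'n) set) \<times> {0..T}) \<times> ((UNIV :: (real^'n) set) \<times> {0..T})"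
  define \<Psi>0 where "\<Psi>0 z = u (fst z) + w (snd z) +
     - (recip_ext m (\<mu> - \<xi> (snd (fst z)) - \<eta> (snd (snd z))) * smooth_cap a b (e_g g (fst (fst z)) (fst (snd z))))" for z
  have usc0: "usc_on ?X \<Psi>0"
    unfolding \<Psi>0_def
  proof (intro usc_on_add)
    have uu: "usc_on (UNIV \<times> {0..T}) u" "usc_on (UNIV \<times> {0..T}) w"
      using u(1) w(1) by (simp_all add: BUSC_def usc_on_def)
    show "usc_on ?X (\<lambda>z. u (fst z))"
      by (rule usc_on_compose[OF uu(1)]) (auto intro!: continuous_intros)
    show "usc_on ?X (\<lambda>z. w (snd z))"
      by (rule usc_on_compose[OF uu(2)]) (auto intro!: continuous_intros)
    show "usc_on ?X (\<lambda>z. - (recip_ext m (\<mu> - \<xi> (snd (fst z)) - \<eta> (snd (snd z))) *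
        smooth_cap a b (e_g g (fst (fst z)) (fst (snd z)))))"
    proof (intro usc_on_continuous continuous_on_minus continuous_on_mult)
      have "continuous_on ?X (\<lambda>z. \<xi> (snd (fst z)))"
        by (rule continuous_on_compose2[OF C1_on_imp_continuous_on[OF \<xi>(1)]]) (auto intro!: continuous_intros)
      moreover have "continuous_on ?X (\<lambda>z. \<eta> (snd (snd z)))"
        by (rule continuous_on_compose2[OF C1_on_imp_continuous_on[OF \<eta>(1)]]) (auto intro!: continuous_intros)
      ultimately have "continuous_on ?X (\<lambda>z. \<mu> - \<xi> (snd (fst z)) - \<eta> (snd (snd z)))"
        by (intro continuous_on_diff continuous_on_const)
      then show "continuous_on ?X (\<lambda>z. recip_ext m (\<mu> - \<xi> (snd (fst z)) - \<eta> (snd (snd z))))"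
        by (rule continuous_on_compose2[OF continuous_on_recip_ext[OF m(1), of UNIV]]) auto
      have "continuous_on ?X (\<lambda>z. (\<lambda>(x, y). e_g g x y) (fst (fst z), fst (snd z)))"
        by (rule continuous_on_compose2[OF continuous_on_e_g]) (auto intro!: continuous_intros)
      then have "continuous_on ?X (\<lambda>z. e_g g (fst (fst z)) (fst (snd z)))" by simp
      then show "continuous_on ?X (\<lambda>z. smooth_cap a b (e_g g (fst (fst z)) (fst (snd z))))"
        by (rule continuous_on_compose2[OF continuous_on_smooth_cap[OF ab(2), of UNIV]]) auto
    qed
  qed
  define R where "R = (A - M) / \<epsilon>"
  let ?K = "(cball (0::real^'n) R \<times> {0::real}) \<times> (cball (0::real^'n) R \<times> {0::real})"
  have "\<Psi>0 z < M + \<sigma>" if zK: "z \<in> ?K" for z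
  proof -
    obtain x y where z: "z = ((x, 0), (y, 0))" using zK by auto
    have "recip_ext m \<mu> = 1 / \<mu>" by (rule recip_ext_eq[OF m(2,1)])
    then show ?thesis using init[of x y] \<sigma>(1) by (simp add: \<Psi>0_def z \<xi>(2) \<eta>(2))
  qed
  moreover have "compact ?K" by (intro compact_Times) auto
  moreover have "?K \<subseteq> ?X" using T by auto
  ultimately obtain r2 where r2: "0 < r2" "\<And>z k. z \<in> ?X \<Longrightarrow> k \<in> ?K \<Longrightarrow> dist k z < r2 \<Longrightarrow> \<Psi>0 z < M + \<sigma>"
    using usc_on_less_near_compact[OF usc0] by metis
  define r where "r = min r1 r2"
  have r: "0 < r" "r \<le> r1" "r \<le> r2" using r1 r2 by (simp_all add: r_def)
  \<comment> \<open>large enough to force \<open>|t - s| < r\<close> at every point that competes with \<open>z0\<close>\<close>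
  define n where "n = (A - M + 1) / r\<^sup>2"
  have AM: "0 \<le> A - M" using uw_le[OF t0 t0, of x0 x0] \<sigma> by linarith
  have n: "0 < n" using AM r by (simp add: n_def)
  define pen where "pen z = \<epsilon> * bracket (fst (fst z)) + \<epsilon> * bracket (fst (snd z)) + \<delta> * snd (fst z) + \<delta> * snd (snd z)
     + n * (snd (fst z) - snd (snd z))\<^sup>2" for z :: "((real^'n) \<times> real) \<times> ((real^'n) \<times> real)"
  have pen_cont: "continuous_on ?X pen"
    unfolding pen_def
    by (intro continuous_intros continuous_on_compose2[OF continuous_on_bracket[of UNIV]]) auto
  define z0 where "z0 = ((x0, t0), (x0, t0))"
  have z0: "z0 \<in> ?X" using t0 by (simp add: z0_def)
  have "smooth_cap a b (e_g g x0 x0) = 0" using smooth_cap_eq[of 0 a b] ab by (simp add: e_g_refl)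
  then have val0: "M + \<sigma> < \<Psi>0 z0 - pen z0"
    using \<sigma> \<delta>(2) \<epsilon>(2) by (simp add: \<Psi>0_def pen_def z0_def)
  \<comment> \<open>all that is needed about points at which the penalised function exceeds \<open>M + \<sigma>\<close>\<close>
  have high: "bracket x \<le> R \<and> bracket y \<le> R \<and> dist t s < r \<and> M + \<sigma> < \<Psi>0 ((x, t), (y, s))
      \<and> recip_ext m (\<mu> - \<xi> t - \<eta> s) * smooth_cap a b (e_g g x y) < A - M"
    if ts: "t \<in> {0..T}" "s \<in> {0..T}" and gt: "M + \<sigma> < \<Psi>0 ((x, t), (y, s)) - pen ((x, t), (y, s))" for x t y s
  proof -
    define P where "P = recip_ext m (\<mu> - \<xi> t - \<eta> s) * smooth_cap a b (e_g g x y)"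
    have P0: "0 \<le> P" unfolding P_def
      using recip_ext_pos[OF m(1)] smooth_cap_nonneg[OF e_g_nonneg ab(1,2)] by (simp add: less_imp_le)
    have nn: "0 \<le> \<epsilon> * bracket x" "0 \<le> \<epsilon> * bracket y" "0 \<le> \<delta> * t" "0 \<le> \<delta> * s" "0 \<le> n * (t - s)\<^sup>2"
      using \<epsilon>0 bracket_pos[of x] bracket_pos[of y] \<delta>(1) ts n by auto
    have eq: "\<Psi>0 ((x, t), (y, s)) = u (x, t) + w (y, s) - P"
      "pen ((x, t), (y, s)) = \<epsilon> * bracket x + \<epsilon> * bracket y + \<delta> * t + \<delta> * s + n * (t - s)\<^sup>2"
      by (simp_all add: \<Psi>0_def pen_def P_def)
    have "\<epsilon> * bracket x \<le> A - M" "\<epsilon> * bracket y \<le> A - M" "n * (t - s)\<^sup>2 \<le> A - M" "P < A - M"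
      "M + \<sigma> < \<Psi>0 ((x, t), (y, s))"
      using gt uw_le[OF ts, of x y] P0 nn \<sigma>(1) eq by linarith+
    moreover from this have "(t - s)\<^sup>2 < r\<^sup>2"
    proof -
      have "n * (t - s)\<^sup>2 < n * r\<^sup>2" using \<open>n * (t - s)\<^sup>2 \<le> A - M\<close> r by (simp add: n_def)
      then show ?thesis using n by simp
    qed
    then have "\<bar>t - s\<bar> < r" using r(1) by (metis abs_of_pos abs_le_square_iff not_le)
    ultimately show ?thesis using \<epsilon>0 by (simp add: R_def P_def field_simps dist_real_def)
  qed
  have "bounded {z \<in> ?X. \<Psi>0 z0 + - pen z0 \<le> \<Psi>0 z + - pen z}"
  proof (rule bounded_subset)
    show "bounded ((cball (0::real^'n) R \<times> {0..T}) \<times> (cball (0::real^'n) R \<times> {0..T}))"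
      by (intro bounded_Times bounded_cball bounded_closed_interval)
    show "{z \<in> ?X. \<Psi>0 z0 + - pen z0 \<le> \<Psi>0 z + - pen z} \<subseteq> (cball 0 R \<times> {0..T}) \<times> (cball 0 R \<times> {0..T})"
    proof
      fix z assume z: "z \<in> {z \<in> ?X. \<Psi>0 z0 + - pen z0 \<le> \<Psi>0 z + - pen z}"
      then obtain x t y s where zz: "z = ((x, t), (y, s))" "t \<in> {0..T}" "s \<in> {0..T}" by auto
      then have "bracket x \<le> R" "bracket y \<le> R" using high[of t s x y] z val0 by auto
      then show "z \<in> (cball 0 R \<times> {0..T}) \<times> (cball 0 R \<times> {0..T})"
        using zz norm_le_bracket[of x] norm_le_bracket[of y] by auto
    qed
  qed
  moreover have "usc_on ?X (\<lambda>z. \<Psi>0 z + - pen z)"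
    by (rule usc_on_add[OF usc0 usc_on_continuous[OF continuous_on_minus[OF pen_cont]]])
  moreover have "closed ?X" by (intro closed_Times) auto
  ultimately obtain z where z: "z \<in> ?X" "\<And>z'. z' \<in> ?X \<Longrightarrow> \<Psi>0 z' + - pen z' \<le> \<Psi>0 z + - pen z"
    using usc_on_attains_max_coercive[of ?X "\<lambda>z. \<Psi>0 z + - pen z" z0] z0 by blast
  obtain x t y s where zz: "z = ((x, t), (y, s))" and ts: "t \<in> {0..T}" "s \<in> {0..T}" using z(1) by auto
  have "M + \<sigma> < \<Psi>0 ((x, t), (y, s)) - pen ((x, t), (y, s))" using val0 z(2)[OF z0] zz by simp
  note hi = high[OF ts this]
  \<comment> \<open>if one of the times is \<open>0\<close>, both are less than \<open>r2\<close>, and the initial bound persists\<close>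
  have near0: "0 < t \<and> 0 < s"
  proof (rule ccontr)
    assume "\<not> (0 < t \<and> 0 < s)"
    then have "t = 0 \<or> s = 0" using ts by auto
    then have "dist ((x, 0), (y, 0)) ((x, t), (y, s)) < r2"
      using hi r(3) by (auto simp: dist_Pair_Pair dist_real_def)
    moreover have "((x, 0), (y, 0)) \<in> ?K"
      using hi norm_le_bracket[of x] norm_le_bracket[of y] by auto
    ultimately have "\<Psi>0 ((x, t), (y, s)) < M + \<sigma>" using r2(2) z(1) zz by metis
    then show False using hi by linarith
  qed
  have arg: "m \<le> \<mu> - \<xi> t - \<eta> s" "\<mu> - \<xi> t - \<eta> s \<le> \<mu> + Dm + \<eta>0"
  proof -
    have "dist t s < r1" using hi r(2) by linarith
    then have "\<bar>\<eta> t - \<eta> s\<bar> < \<eta>0" using r1(2)[OF ts] by (simp add: dist_real_def)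
    then show "m \<le> \<mu> - \<xi> t - \<eta> s" "\<mu> - \<xi> t - \<eta> s \<le> \<mu> + Dm + \<eta>0"
      using drv[OF ts(1)] \<eta>0(2) m(3) by (auto simp: abs_less_iff field_simps)
  qed
  \<comment> \<open>the penalty is less than \<open>A - M \<le> 2A\<close>, and the denominator is at most \<open>\<mu> + Dm + \<eta>0\<close>\<close>
  have exy: "e_g g x y \<le> a"
  proof (rule ccontr)
    assume "\<not> e_g g x y \<le> a"
    then have "a \<le> smooth_cap a b (e_g g x y)" using smooth_cap_ge[of a "e_g g x y" b] ab by simp
    moreover have "smooth_cap a b (e_g g x y) < a"
    proof -
      let ?\<rho> = "smooth_cap a b (e_g g x y)"
      have pos: "0 < \<mu> - \<xi> t - \<eta> s" using arg(1) m(1) by linarith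
      have "?\<rho> / (\<mu> - \<xi> t - \<eta> s) < 2 * A"
        using hi K(3) recip_ext_eq[OF arg(1) m(1)] by (simp add: A_def)
      then have "?\<rho> < 2 * A * (\<mu> - \<xi> t - \<eta> s)" using pos by (simp add: pos_divide_less_eq)
      also have "\<dots> \<le> 2 * A * (\<mu> + Dm + \<eta>0)" using arg(2) A0 by (intro mult_left_mono) auto
      also have "\<dots> \<le> a" using \<eta>0(3) by (simp add: algebra_simps)
      finally show ?thesis .
    qed
    ultimately show False by linarith
  qed
  have max_u: "u (x', t') - (recip_ext m ((\<mu> - \<eta> s) - \<xi> t') * smooth_cap a b (e_g g x' y) + \<epsilon> * bracket x' + \<delta> * t' + n * (t' - s)\<^sup>2)
      \<le> u (x, t) - (recip_ext m ((\<mu> - \<eta> s) - \<xi> t) * smooth_cap a b (e_g g x y) + \<epsilon> * bracket x + \<delta> * t + n * (t - s)\<^sup>2)"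
    if "t' \<in> {0<..T}" for x' t'
  proof -
    have "((x', t'), (y, s)) \<in> ?X" using that ts by auto
    note le = z(2)[OF this]
    have swap: "\<mu> - \<eta> s - \<xi> r = \<mu> - \<xi> r - \<eta> s" for r by simp
    from le show ?thesis
      unfolding zz \<Psi>0_def pen_def fst_conv snd_conv swap by linarith
  qed
  \<comment> \<open>the same in the other variable, where the symmetry of the energy is used\<close>
  have max_w: "w (y', s') - (recip_ext m ((\<mu> - \<xi> t) - \<eta> s') * smooth_cap a b (e_g g y' x) + \<epsilon> * bracket y' + \<delta> * s' + n * (s' - t)\<^sup>2)
      \<le> w (y, s) - (recip_ext m ((\<mu> - \<xi> t) - \<eta> s) * smooth_cap a b (e_g g y x) + \<epsilon> * bracket y + \<delta> * s + n * (s - t)\<^sup>2)"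
    if "s' \<in> {0<..T}" for y' s'
  proof -
    have "((x, t), (y', s')) \<in> ?X" using that ts by auto
    from z(2)[OF this] show ?thesis
      unfolding zz \<Psi>0_def pen_def fst_conv snd_conv e_g_commute[of _ x] power2_commute[of _ t] by linarith
  qed
  have "\<delta> + 2 * n * (t - s) \<le> \<epsilon> * (L1 * Q)"
    unfolding Q_def using near0 ts arg(1)
    by (intro doubled_max_inequality[OF T u(2) \<xi>(1) e ab m(1) _ less_imp_le[OF \<epsilon>0] \<epsilon>(1) _ exy _ max_u] L1(2)) auto
  moreover have "\<delta> + 2 * n * (s - t) \<le> \<epsilon> * (L2 * Q)"
    unfolding Q_def using near0 ts arg(1) exy e_g_commute[of x y]
    by (intro doubled_max_inequality[OF T w(2) \<eta>(1) e ab m(1) _ less_imp_le[OF \<epsilon>0] \<epsilon>(1) _ _ _ max_w] L2(2)) auto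
  moreover have "2 * n * (t - s) + 2 * n * (s - t) = 0" by (simp add: algebra_simps)
  ultimately show False using \<epsilon>L by linarith
qed

end

section \<open>Moduli of continuity\<close>

text \<open>Subadditivity: an interval of length \<open>r\<close> is covered by at most \<open>r/d + 1\<close> intervals of a length \<open>d\<close> with \<open>\<omega> d \<le> \<sigma>\<close>.\<close>
lemma modulus_le_affine:
  assumes "modulus \<omega>" "0 < \<sigma>"
  obtains K where "0 \<le> K" "\<And>r. 0 \<le> r \<Longrightarrow> \<omega> r \<le> \<sigma> + K * r"
proof -
  have \<omega>: "\<And>r. 0 \<le> r \<Longrightarrow> 0 \<le> \<omega> r" "mono_on {0..} \<omega>" "\<omega> 0 = 0" "(\<omega> \<longlongrightarrow> 0) (at_right 0)"
    and sub: "\<And>r s. 0 \<le> r \<Longrightarrow> 0 \<le> s \<Longrightarrow> \<omega> (r + s) \<le> \<omega> r + \<omega> s"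
    using assms(1) by (auto simp: modulus_def)
  have "\<forall>\<^sub>F r in at_right 0. \<omega> r < \<sigma>" using order_tendstoD(2)[OF \<omega>(4) assms(2)] .
  then obtain b where b: "0 < b" "\<And>r. 0 < r \<Longrightarrow> r < b \<Longrightarrow> \<omega> r < \<sigma>"
    unfolding eventually_at_right_field by auto
  define d where "d = b / 2"
  have d: "0 < d" "\<omega> d \<le> \<sigma>" using b by (auto simp: d_def intro: less_imp_le)
  have mult: "\<omega> (real n * d) \<le> real n * \<omega> d" for n
  proof (induction n)
    case (Suc n)
    have "\<omega> (real (Suc n) * d) = \<omega> (real n * d + d)" by (simp add: algebra_simps)
    also have "\<dots> \<le> \<omega> (real n * d) + \<omega> d" using d by (intro sub) auto
    finally show ?case using Suc by (simp add: algebra_simps)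
  qed (simp add: \<omega>(3))
  have "\<omega> r \<le> \<sigma> + \<omega> d / d * r" if "0 \<le> r" for r
  proof -
    define n where "n = nat \<lceil>r / d\<rceil>"
    have n: "r / d \<le> real n" "real n \<le> r / d + 1"
      using that d of_int_ceiling_le_add_one[of "r / d"] le_of_int_ceiling[of "r / d"] by (auto simp: n_def)
    have "\<omega> r \<le> \<omega> (real n * d)"
      by (rule mono_onD[OF \<omega>(2)]) (use that n d in \<open>auto simp: field_simps\<close>)
    also have "\<dots> \<le> real n * \<omega> d" by (rule mult)
    also have "\<dots> \<le> (r / d + 1) * \<omega> d" using n d \<omega>(1)[of d] by (intro mult_right_mono) auto
    also have "\<dots> \<le> \<sigma> + \<omega> d / d * r" using d by (simp add: algebra_simps)
    finally show ?thesis .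
  qed
  moreover have "0 \<le> \<omega> d / d" using d \<omega>(1)[of d] by simp
  ultimately show thesis using that by blast
qed

lemma linear_minus_parabola_le:
  fixes K l r :: real
  assumes "0 < l"
  shows "K * r - l * r\<^sup>2 \<le> K\<^sup>2 / (4 * l)"
proof -
  have "0 \<le> (2 * l * r - K)\<^sup>2" by simp
  then have "4 * l * (K * r - l * r\<^sup>2) \<le> K\<^sup>2" by (simp add: power2_eq_square algebra_simps)
  then show ?thesis using assms by (simp add: pos_le_divide_eq mult_ac)
qed

lemma le_theta:
  assumes "modulus \<omega>" "\<And>r. 0 \<le> r \<Longrightarrow> f r \<le> \<omega> r" "0 < D" "0 \<le> r"
  shows "f r - r\<^sup>2 / (2 * D) \<le> theta f (1 / ereal D)"
proof -
  have th: "theta f (1 / ereal D) = (SUP r\<in>{0..}. f r - 1 / D * r\<^sup>2 / 2)"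
    using assms(3) by (simp add: theta_def one_ereal_def)
  obtain K where K: "\<And>r. 0 \<le> r \<Longrightarrow> \<omega> r \<le> 1 + K * r"
    using modulus_le_affine[OF assms(1), of 1] by auto
  have "bdd_above ((\<lambda>r. f r - 1 / D * r\<^sup>2 / 2) ` {0..})"
  proof (rule bdd_aboveI2)
    fix r :: real assume "r \<in> {0..}"
    then have "f r \<le> 1 + K * r" using assms(2)[of r] K[of r] by auto
    then show "f r - 1 / D * r\<^sup>2 / 2 \<le> 1 + K\<^sup>2 / (4 * (1 / (2 * D)))"
      using linear_minus_parabola_le[of "1 / (2 * D)" K r] assms(3) by simp
  qed
  then have "f r - 1 / D * r\<^sup>2 / 2 \<le> theta f (1 / ereal D)"
    unfolding th using assms(4) by (intro cSUP_upper) auto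
  then show ?thesis by (simp add: mult.commute)
qed

text \<open>
  If \<open>D > 0\<close>, any \<open>\<nu> \<le> 2D\<close> works, because \<^const>\<open>theta\<close> carries the factor \<open>1/2\<close>.  If \<open>D = 0\<close>, then
  \<^const>\<open>theta\<close> vanishes by convention, and \<open>\<omega> r \<le> \<kappa>/2 + K r\<close> gives the bound
  \<open>\<kappa>/2 + K\<^sup>2 \<nu>/4\<close>, which is at most \<open>\<kappa>\<close> for small \<open>\<nu>\<close>.
\<close>
lemma eventually_le_theta:
  assumes "modulus \<omega>" "\<And>r. 0 \<le> r \<Longrightarrow> f r \<le> \<omega> r" "f 0 = 0" "0 \<le> D" "0 < \<kappa>"
  obtains \<mu> where "D < \<mu>" "\<And>\<nu> r. D < \<nu> \<Longrightarrow> \<nu> \<le> \<mu> \<Longrightarrow> 0 \<le> r \<Longrightarrow> f r - r\<^sup>2 / \<nu> \<le> theta f (1 / ereal D) + \<kappa>"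
    "0 \<le> theta f (1 / ereal D)"
proof (cases "D = 0")
  case True
  have th: "theta f (1 / ereal D) = 0"
    by (simp add: True theta_def one_ereal_def)
  have "0 < \<kappa> / 2" using assms(5) by simp
  then obtain K where K: "0 \<le> K" "\<And>r. 0 \<le> r \<Longrightarrow> \<omega> r \<le> \<kappa> / 2 + K * r"
    using modulus_le_affine[OF assms(1)] by blast
  define \<mu> where "\<mu> = 2 * \<kappa> / (K\<^sup>2 + 1)"
  have "0 < \<mu>" using assms(5) by (simp add: \<mu>_def add_nonneg_pos)
  moreover have "f r - r\<^sup>2 / \<nu> \<le> \<kappa>" if "0 < \<nu>" "\<nu> \<le> \<mu>" "0 \<le> r" for \<nu> r
  proof -
    have "f r - r\<^sup>2 / \<nu> \<le> \<kappa> / 2 + (K * r - 1 / \<nu> * r\<^sup>2)"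
      using assms(2)[OF that(3)] K(2)[OF that(3)] by simp
    also have "\<dots> \<le> \<kappa> / 2 + K\<^sup>2 / (4 * (1 / \<nu>))"
      using linear_minus_parabola_le[of "1 / \<nu>" K r] that(1) by simp
    also have "K\<^sup>2 / (4 * (1 / \<nu>)) = K\<^sup>2 * \<nu> / 4" using that(1) by simp
    also have "K\<^sup>2 * \<nu> \<le> (K\<^sup>2 + 1) * \<mu>" using that(1,2) by (intro mult_mono) auto
    also have "(K\<^sup>2 + 1) * \<mu> = 2 * \<kappa>" by (simp add: \<mu>_def) (smt (verit) zero_le_power2)
    finally show ?thesis by simp
  qed
  ultimately show thesis using that[of \<mu>] True th by simp
next
  case False
  then have D: "0 < D" using assms(4) by simp
  have le: "f r - r\<^sup>2 / (2 * D) \<le> theta f (1 / ereal D)" if "0 \<le> r" for r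
    by (rule le_theta[OF assms(1,2) D that])
  show thesis
  proof (rule that[of "2 * D"])
    fix \<nu> r :: real assume \<nu>: "D < \<nu>" "\<nu> \<le> 2 * D" and r: "0 \<le> r"
    then have "r\<^sup>2 / (2 * D) \<le> r\<^sup>2 / \<nu>" using D by (intro divide_left_mono) auto
    then show "f r - r\<^sup>2 / \<nu> \<le> theta f (1 / ereal D) + \<kappa>" using le[OF r] assms(5) by linarith
  qed (use D le[of 0] assms(3) in auto)
qed

section \<open>The comparison theorem\<close>

lemma abs_le_sup_norm:
  assumes "bounded (range f)"
  shows "\<bar>f x\<bar> \<le> sup_norm f UNIV"
proof -
  obtain B where "\<And>x. \<bar>f x\<bar> \<le> B" using assms by (auto simp: bounded_iff)
  then show ?thesis unfolding sup_norm_def by (intro cSUP_upper bdd_aboveI2) auto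
qed

theorem theorem1p1:
  fixes g :: "real^'n \<Rightarrow> real^'n^'n"
    and T C \<Upsilon> :: real
    and \<xi> \<zeta> :: "real \<Rightarrow> real"
    and u\<^sub>0 v\<^sub>0 :: "real^'n \<Rightarrow> real"
    and \<omega>u \<omega>v :: "real \<Rightarrow> real"
    and u v :: "(real^'n) \<times> real \<Rightarrow> real"
  assumes "T > 0"
    and "C2_on g UNIV"
    and "\<And>x. transpose (g x) = g x"
    and "C > 0"
    and "\<And>x w. 1 / C * (norm w)\<^sup>2 \<le> (g x *v w) \<bullet> w \<and> (g x *v w) \<bullet> w \<le> C * (norm w)\<^sup>2"
    and "\<Upsilon> > 0"
    and "C1_on (\<lambda>(x, y). e_g g x y) {(x, y). d_g g x y < \<Upsilon>}"
    and "\<xi> \<in> C1_0 T" and "\<zeta> \<in> C1_0 T"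
    and "u\<^sub>0 \<in> BUC_g g" and "modulus_of g \<omega>u u\<^sub>0"
    and "v\<^sub>0 \<in> BUC_g g" and "modulus_of g \<omega>v v\<^sub>0"
    and "u \<in> BUSC (UNIV \<times> {0..T})"
    and "viscosity_subsolution (eikonal g T \<xi>) T u"
    and "\<And>x. u (x, 0) \<le> u\<^sub>0 x"
    and "v \<in> BLSC (UNIV \<times> {0..T})"
    and "viscosity_supersolution (eikonal g T \<zeta>) T v"
    and "\<And>x. v (x, 0) \<ge> v\<^sub>0 x"
    and "ereal (Delta_plus T \<xi> \<zeta> + Delta_minus T \<xi> \<zeta>)
           < 1 / ereal (2 * (sup_norm u\<^sub>0 UNIV + sup_norm v\<^sub>0 UNIV)) * ereal (\<Upsilon>\<^sup>2)"
  shows "(SUP z\<in>UNIV \<times> {0..T}. u z - v z)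
           \<le> (SUP x. u\<^sub>0 x - v\<^sub>0 x)
             + theta (\<lambda>r. min (\<omega>u r) (\<omega>v r)) (1 / ereal (Delta_plus T \<xi> \<zeta>))"
proof -
  note T = assms(1)
  obtain g' where "\<And>x. (g has_derivative blinfun_apply (g' x)) (at x within UNIV)"
    using assms(2) unfolding C2_on_def by auto
  then have "continuous_on UNIV g" by (intro has_derivative_continuous_on)
  then interpret elliptic_metric g C
    using assms(3,4,5) by unfold_locales auto
  have \<xi>: "C1_on \<xi> {0..T}" "\<xi> 0 = 0" and \<zeta>: "C1_on \<zeta> {0..T}" "\<zeta> 0 = 0"
    using assms(8,9) by (auto simp: C1_0_def)
  define \<eta> where "\<eta> t = - \<zeta> t" for t
  have \<eta>: "C1_on \<eta> {0..T}" "\<eta> 0 = 0"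
    using C1_on_diff[OF C1_on_const[of 0] \<zeta>(1)] \<zeta>(2) by (simp_all add: \<eta>_def[abs_def])
  define w where "w z = - v z" for z
  have w_sub: "viscosity_subsolution (eikonal g T \<eta>) T w"
    using supersolution_uminus[OF assms(18) \<zeta>(1) T] by (simp add: \<eta>_def[abs_def] w_def[abs_def])
  have w_usc: "w \<in> BUSC (UNIV \<times> {0..T})"
  proof -
    have "{z \<in> S. - v z < c} = {z \<in> S. - c < v z}" for S c by auto
    moreover have "bounded ((\<lambda>z. - v z) ` S)" if "bounded (v ` S)" for S
      using that by (simp add: bounded_iff)
    ultimately show ?thesis using assms(17) by (simp add: BUSC_def BLSC_def w_def[abs_def])
  qed
  define Ku where "Ku = sup_norm u\<^sub>0 UNIV"
  define Kv where "Kv = sup_norm v\<^sub>0 UNIV"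
  define A where "A = Ku + Kv"
  have Ku: "\<bar>u\<^sub>0 x\<bar> \<le> Ku" and Kv: "\<bar>v\<^sub>0 x\<bar> \<le> Kv" for x
    using assms(10,12) by (auto simp: Ku_def Kv_def BUC_g_def intro: abs_le_sup_norm)
  have A0: "0 \<le> A" using Ku[of 0] Kv[of 0] by (simp add: A_def)
  define M where "M = (SUP x. u\<^sub>0 x - v\<^sub>0 x)"
  have M: "u\<^sub>0 x - v\<^sub>0 x \<le> M" for x
    unfolding M_def
  proof (rule cSUP_upper)
    show "bdd_above (range (\<lambda>x. u\<^sub>0 x - v\<^sub>0 x))"
      by (rule bdd_aboveI2[of _ _ A]) (use Ku Kv in \<open>simp add: A_def abs_le_iff; smt (verit)\<close>)
  qed simp
  have MA: "- A \<le> M" using M[of 0] Ku[of 0] Kv[of 0] by (simp add: A_def)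
  define Dp where "Dp = Delta_plus T \<xi> \<zeta>"
  define Dm where "Dm = Delta_minus T \<xi> \<zeta>"
  have "continuous_on {0..T} (\<lambda>s. \<xi> s - \<zeta> s)"
    by (intro continuous_on_diff C1_on_imp_continuous_on \<xi> \<zeta>)
  then have "bounded ((\<lambda>s. \<xi> s - \<zeta> s) ` {0..T})"
    by (intro compact_imp_bounded compact_continuous_image compact_Icc)
  then obtain B where "\<forall>r \<in> (\<lambda>s. \<xi> s - \<zeta> s) ` {0..T}. norm r \<le> B" unfolding bounded_iff by blast
  then have B: "\<bar>\<xi> s - \<zeta> s\<bar> \<le> B" if "s \<in> {0..T}" for s using that by simp
  have Dp: "\<xi> s - \<zeta> s \<le> Dp" and Dm: "- (\<xi> s - \<zeta> s) \<le> Dm" if "s \<in> {0..T}" for s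
  proof -
    show "\<xi> s - \<zeta> s \<le> Dp" unfolding Dp_def Delta_plus_def
      by (rule cSUP_upper[OF that bdd_aboveI2[of _ _ B]]) (use B in fastforce)
    show "- (\<xi> s - \<zeta> s) \<le> Dm" unfolding Dm_def Delta_minus_def
      by (rule cSUP_upper[OF that bdd_aboveI2[of _ _ B]]) (use B in fastforce)
  qed
  have D0: "0 \<le> Dp" "0 \<le> Dm" using Dp[of 0] Dm[of 0] T \<xi>(2) \<zeta>(2) by auto
  have small: "(Dp + Dm) * (2 * A) < \<Upsilon>\<^sup>2"
  proof (cases "A = 0")
    case True
    then show ?thesis using assms(6) by simp
  next
    case False
    then have "1 / ereal (2 * A) * ereal (\<Upsilon>\<^sup>2) = ereal (1 / (2 * A) * \<Upsilon>\<^sup>2)"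
      by (simp add: one_ereal_def)
    then have "Dp + Dm < 1 / (2 * A) * \<Upsilon>\<^sup>2"
      using assms(20) by (simp add: Dp_def Dm_def A_def Ku_def Kv_def)
    then show ?thesis using False A0 by (simp add: pos_less_divide_eq)
  qed
  define f where "f r = min (\<omega>u r) (\<omega>v r)" for r
  define \<theta> where "\<theta> = theta f (1 / ereal Dp)"
  have mod: "modulus \<omega>u" "modulus \<omega>v" and \<omega>u: "\<And>x y. \<bar>u\<^sub>0 x - u\<^sub>0 y\<bar> \<le> \<omega>u (d_g g x y)"
    and \<omega>v: "\<And>x y. \<bar>v\<^sub>0 x - v\<^sub>0 y\<bar> \<le> \<omega>v (d_g g x y)"
    using assms(11,13) by (auto simp: modulus_of_def)
  have f: "f r \<le> \<omega>u r" "f 0 = 0" for r using mod by (auto simp: f_def modulus_def)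
  have main: "u (x0, t0) - v (x0, t0) \<le> M + \<theta> + \<kappa>" if t0: "t0 \<in> {0..T}" and \<kappa>: "0 < \<kappa>" for x0 t0 \<kappa>
  proof -
    obtain \<mu>1 where \<mu>1: "Dp < \<mu>1" "\<And>\<nu> r. Dp < \<nu> \<Longrightarrow> \<nu> \<le> \<mu>1 \<Longrightarrow> 0 \<le> r \<Longrightarrow> f r - r\<^sup>2 / \<nu> \<le> \<theta> + \<kappa>" "0 \<le> \<theta>"
      using eventually_le_theta[OF mod(1) f D0(1) \<kappa>] unfolding \<theta>_def by metis
    define \<mu> where "\<mu> = min \<mu>1 (Dp + (\<Upsilon>\<^sup>2 - (Dp + Dm) * (2 * A)) / (2 * A + 1) / 2)"
    have \<mu>: "Dp < \<mu>" "\<mu> \<le> \<mu>1" using \<mu>1(1) small A0 by (simp_all add: \<mu>_def)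
    have \<mu>0: "0 < \<mu>" using \<mu> D0 by linarith
    define q where "q = (\<mu> + Dm) * (2 * A)"
    have q0: "0 \<le> q" using \<mu>0 D0 A0 by (simp add: q_def)
    have q: "q < \<Upsilon>\<^sup>2"
    proof -
      define k where "k = \<Upsilon>\<^sup>2 - (Dp + Dm) * (2 * A)"
      have k: "0 < k" using small by (simp add: k_def)
      have "\<mu> - Dp \<le> k / (2 * A + 1) / 2" unfolding \<mu>_def k_def by linarith
      then have "(\<mu> - Dp) * (2 * A) \<le> k / (2 * A + 1) / 2 * (2 * A + 1)"
        using \<mu> A0 by (intro mult_mono) auto
      also have "\<dots> = k / 2"
      proof -
        have "k / r / 2 * r = k / 2" if "0 < r" for r :: real using that by simp
        then show ?thesis using A0 by (meson add_nonneg_pos mult_nonneg_nonneg zero_le_numeral zero_less_one)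
      qed
      finally show ?thesis using k by (simp add: q_def k_def algebra_simps)
    qed
    \<comment> \<open>truncation levels with \<open>q < a < b < \<Upsilon>\<^sup>2\<close>\<close>
    define a where "a = (2 * q + \<Upsilon>\<^sup>2) / 3"
    define b where "b = (q + 2 * \<Upsilon>\<^sup>2) / 3"
    have ab: "0 < a" "a < b" "b < \<Upsilon>\<^sup>2" "q < a" using q q0 by (auto simp: a_def b_def)
    have init: "u (x, 0) + w (y, 0) - smooth_cap a b (e_g g x y) / \<mu> \<le> M + \<theta> + \<kappa>" for x y
    proof -
      have uw: "u (x, 0) + w (y, 0) \<le> u\<^sub>0 x - v\<^sub>0 y" using assms(16)[of x] assms(19)[of y] by (simp add: w_def)
      \<comment> \<open>beyond the truncation level the penalty is at least \<open>2A\<close>, which brings \<open>u\<^sub>0 - v\<^sub>0 \<le> A\<close> down to \<open>-A \<le> M\<close>\<close>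
      show ?thesis
      proof (cases "e_g g x y \<le> a")
        case True
        then have "smooth_cap a b (e_g g x y) / \<mu> = (d_g g x y)\<^sup>2 / \<mu>" using smooth_cap_eq ab(2) by (simp add: e_g_def)
        moreover have "u\<^sub>0 x - v\<^sub>0 y \<le> M + f (d_g g x y)"
          using M[of x] M[of y] \<omega>u[of x y] \<omega>v[of x y] by (simp add: f_def min_def abs_le_iff)
        moreover have "f (d_g g x y) - (d_g g x y)\<^sup>2 / \<mu> \<le> \<theta> + \<kappa>" by (rule \<mu>1(2)[OF \<mu> d_g_nonneg])
        ultimately show ?thesis using uw by linarith
      next
        case False
        then have "a \<le> smooth_cap a b (e_g g x y)" using smooth_cap_ge ab by simp
        then have "a / \<mu> \<le> smooth_cap a b (e_g g x y) / \<mu>" using \<mu>0 by (simp add: divide_right_mono)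
        moreover have "2 * A \<le> a / \<mu>"
        proof -
          have "2 * A * \<mu> \<le> q" using D0 A0 by (simp add: q_def algebra_simps)
          then show ?thesis using ab(4) \<mu>0 by (simp add: pos_le_divide_eq)
        qed
        moreover have "u\<^sub>0 x - v\<^sub>0 y \<le> A" using Ku[of x] Kv[of y] by (simp add: A_def abs_le_iff)
        ultimately show ?thesis using uw MA \<mu>1(3) \<kappa> by linarith
      qed
    qed
    have "u (x0, t0) + w (x0, t0) \<le> M + \<theta> + \<kappa>"
    proof (rule doubled_comparison[OF T assms(6,7) \<xi> \<eta> assms(14,15) w_usc w_sub _ _ _ _ \<mu>(1) \<mu>0 ab(1-3) _ _ _ init t0])
      show "u (x, 0) \<le> Ku" for x using assms(16)[of x] Ku[of x] by simp
      show "w (x, 0) \<le> Kv" for x using assms(19)[of x] Kv[of x] by (simp add: w_def)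
      show "\<xi> t + \<eta> t \<le> Dp" "- Dm \<le> \<xi> t + \<eta> t" if "t \<in> {0..T}" for t
        using Dp[OF that] Dm[OF that] by (simp_all add: \<eta>_def)
      show "0 \<le> Ku + Kv" "(\<mu> + Dm) * (2 * (Ku + Kv)) < a" "- (Ku + Kv) \<le> M + \<theta> + \<kappa>"
        using A0 ab(4) MA \<mu>1(3) \<kappa> by (simp_all add: A_def q_def)
    qed
    then show ?thesis by (simp add: w_def)
  qed
  have "u z - v z \<le> M + \<theta>" if "z \<in> UNIV \<times> {0..T}" for z
  proof (rule field_le_epsilon)
    fix \<kappa> :: real assume "0 < \<kappa>"
    then show "u z - v z \<le> M + \<theta> + \<kappa>" using main[of "snd z" \<kappa> "fst z"] that by auto
  qed
  then have "(SUP z\<in>UNIV \<times> {0..T}. u z - v z) \<le> M + \<theta>"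
    using T by (intro cSUP_least) auto
  then show ?thesis by (simp add: M_def \<theta>_def f_def[abs_def] Dp_def)
qed

end
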